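(* Let $n\ge1$, let $\underline{k}$ be a reverse-Catalan composition of $n$, and let $w$ be a word of content $\underline{k}$. (1) $\mathrm{tree}(w)\in\mathrm{Slide}^\psi(\underline{k})$, with its $\psi$ $\underline{k}$-slide edge labels reading $w$ from the root outward, if and only if $w$ avoids the patterns $2{-}1{-}2$ and $23{-}\overline{2}{-}1$, and $$\mathrm{TotalRep}_w(i)+\ell_w(i)\ge \mathrm{z}(i)\quad\text{for all } i \text{ with } k_i>0.$$ (2) $\mathrm{tree}(w)\in\mathrm{Slide}^\omega(\underline{k})$, with its $\omega$ $\underline{k}$-slide edge labels reading $w$ from the root outward, if and only if $w$ avoids the patterns $2{-}1{-}2$ and $23{-}\overline{2}{-}1$, and $$\mathrm{BigRep}_w(i)\ge \mathrm{z}(i)\quad\text{for all } i \text{ with } k_i>0.$$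
   Context: **Compositions and words.** A composition of $n$ is an $n$-tuple $\underline{k}=(k_1,\dots,k_n)$ of nonnegative integers with sum $n$. It is reverse-Catalan if $k_{n-i+1}+\dots+k_n\ge i$ for all $1\le i\le n$. $\mathrm{z}(i)=\#\{j>i: k_j=0\}$. A word $w=w_1\cdots w_n$ has content $\underline{k}$ if each letter $i\in\{1,\dots,n\}$ occurs exactly $k_i$ times. The word $w$ avoids $2{-}1{-}2$ if there are no indices $p<q<r$ with $w_p=w_r>w_q$. It avoids $23{-}\overline{2}{-}1$ if whenever $p+1<q$ and $w_q<w_p<w_{p+1}$, there is $s$ with $p+1<s<q$ and $w_s=w_p$. For $i$ occurring in $w$, let $k(i,j)$ be the number of $j$'s in $w$ to the right of the rightmost $i$. Define $$\mathrm{TotalRep}_w(i)=\sum_{j\ne i}\max(k(i,j)-1,0),\qquad \mathrm{BigRep}_w(i)=\sum_{j=i+1}^n\max(k(i,j)-1,0),$$ and let $\ell_w(i)$ be the number of $i$'s in the rightmost maximal consecutive group of $i$'s in $w$. **Trees.** Labels are ordered $a<b<c<1<\dots<n$. A stable tree is a finite tree whose non-leaf vertices all have degree at least 3 and whose leaves are bijectively labeled by $\{a,b,c,1,\dots,n\}$, up to label-preserving isomorphism. An internal edge joins two non-leaf vertices. **Slide labelings.** The $\omega$ (resp. $\psi$) $\underline{k}$-slide labeling of a stable tree $T$ is the result of the following procedure, if it never fails. For $\ell=n,n-1,\dots,1$ in this order, do the following $k_\ell$ times: let $T'$ be $T$ with all already labeled internal edges contracted; let $e$ be the first internal edge of $T'$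 on the path from leaf $\ell$ to leaf $a$ (fail if none exists); let $v_\ell$ be the vertex of $T'$ adjacent to $\ell$ and $v$ the other endpoint of $e$; let $m_\ell$ be the smallest leaf label among branches at $v_\ell$ in $T'$ not containing $a$ or $\ell$, and $m_a$ the smallest leaf label among branches at $v$ not containing $a$ or $\ell$; if $\ell\ge m_\ell\ge m_a$ (resp. $m_\ell\ge m_a$), label $e$ with $\ell$, otherwise fail. $\mathrm{Slide}^\omega(\underline{k})$ (resp. $\mathrm{Slide}^\psi(\underline{k})$) is the set of stable trees admitting an $\omega$ (resp. $\psi$) $\underline{k}$-slide labeling (by a known theorem this agrees with the definition by iterated slides). Such trees are trivalent with $n$ internal edges, all labeled, and $a,b$ have a common neighbor (the root). **The caterpillar tree $\mathrm{tree}(w)$.** Given a word $w$ of content $\underline{k}$: 1. Take a path with $n$ edges (the internal edges) and attach leaf edges so that it becomes trivalent. 2. The left end is the root; label its two leaves $a$ and $b$. 3. Label the internal edges from left to right with the letters of $w$. 4. For consecutive internal edges labeled $x$ (left) and $y$ (right), the leaf between them is a descent leaf if $x>y$ and a nondescent leaf if $x\le y$. Of the two leaves at the right end, one is declared a descent leaf and the other a nondescent leaf (the rightmost one). 5. Label each descent leaf with the label of the internal edge immediately to its left. 6. List the remaining unused labels among $c,1,\dots,n$. 7. From left to right, label each nondescent leaf by the smallest remaining unused label, unless that label equals the label of the internal edge immediately to the right of that leaf, in which case use the second smallest unused label. 8. Forget the edge labels. If the resulting leaf labels are not all distinct, the tree is not a slide tree. *)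

theory Defs
  imports Main
begin

section \<open>Compositions and words\<close>

text \<open>
  A composition of \<open>n\<close> is a function on naturals, of which only the values at
  \<open>1, \<dots>, n\<close> matter.  Words are lists, with 0-based positions.
\<close>

definition composition :: "nat \<Rightarrow> (nat \<Rightarrow> nat) \<Rightarrow> bool" where
  "composition n k \<longleftrightarrow> (\<Sum>i=1..n. k i) = n"

definition reverse_Catalan :: "nat \<Rightarrow> (nat \<Rightarrow> nat) \<Rightarrow> bool" where
  "reverse_Catalan n k \<longleftrightarrow> (\<forall>i\<in>{1..n}. (\<Sum>j=n-i+1..n. k j) \<ge> i)"

definition zeros_after :: "nat \<Rightarrow> (nat \<Rightarrow> nat) \<Rightarrow> nat \<Rightarrow> nat" where
  "zeros_after n k i = card {j. i < j \<and> j \<le> n \<and> k j = 0}"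

definition has_content :: "nat \<Rightarrow> (nat \<Rightarrow> nat) \<Rightarrow> nat list \<Rightarrow> bool" where
  "has_content n k w \<longleftrightarrow> set w \<subseteq> {1..n} \<and> (\<forall>i\<in>{1..n}. count_list w i = k i)"

definition avoids_2_1_2 :: "nat list \<Rightarrow> bool" where
  "avoids_2_1_2 w \<longleftrightarrow>
     \<not> (\<exists>p q r. p < q \<and> q < r \<and> r < length w \<and> w ! p = w ! r \<and> w ! r > w ! q)"

definition avoids_23_bar2_1 :: "nat list \<Rightarrow> bool" where
  "avoids_23_bar2_1 w \<longleftrightarrow>
     (\<forall>p q. p + 1 < q \<and> q < length w \<and> w ! q < w ! p \<and> w ! p < w ! (p + 1) \<longrightarrow>
        (\<exists>s. p + 1 < s \<and> s < q \<and> w ! s = w ! p))"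

text \<open>The quantity \<open>k(i,j)\<close>; meaningful when \<open>i\<close> occurs in \<open>w\<close>.\<close>

definition count_right :: "nat list \<Rightarrow> nat \<Rightarrow> nat \<Rightarrow> nat" where
  "count_right w i j = count_list (takeWhile (\<lambda>x. x \<noteq> i) (rev w)) j"

text \<open>Truncated subtraction \<open>m - 1\<close> on naturals is \<open>max (m - 1) 0\<close>.\<close>

definition TotalRep :: "nat \<Rightarrow> nat list \<Rightarrow> nat \<Rightarrow> nat" where
  "TotalRep n w i = (\<Sum>j\<in>{1..n} - {i}. count_right w i j - 1)"

definition BigRep :: "nat \<Rightarrow> nat list \<Rightarrow> nat \<Rightarrow> nat" where
  "BigRep n w i = (\<Sum>j=i+1..n. count_right w i j - 1)"

definition last_group :: "nat list \<Rightarrow> nat \<Rightarrow> nat" where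
  "last_group w i = length (takeWhile (\<lambda>x. x = i) (dropWhile (\<lambda>x. x \<noteq> i) (rev w)))"


section \<open>Stable trees\<close>

text \<open>
  The ordered leaf labels \<open>a < b < c < 1 < \<dots> < n\<close> are the integers
  \<open>-2 < -1 < 0 < 1 < \<dots> < n\<close>.  An edge is the set of its two end points.  The labelling
  function is only meaningful on leaves.  Trees are represented concretely rather than as
  isomorphism classes; every notion below is invariant under label-preserving isomorphism.
\<close>

record 'v ltree =
  verts :: "'v set"
  edges :: "'v set set"
  lab :: "'v \<Rightarrow> int"

abbreviation label_a :: int where "label_a \<equiv> -2"
abbreviation label_b :: int where "label_b \<equiv> -1"

definition is_path :: "'v ltree \<Rightarrow> 'v \<Rightarrow> 'v list \<Rightarrow> 'v \<Rightarrow> bool" where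
  "is_path T x p y \<longleftrightarrow>
     p \<noteq> [] \<and> hd p = x \<and> last p = y \<and> distinct p \<and> set p \<subseteq> verts T \<and>
     (\<forall>i. i + 1 < length p \<longrightarrow> {p ! i, p ! (i + 1)} \<in> edges T)"

definition is_tree :: "'v ltree \<Rightarrow> bool" where
  "is_tree T \<longleftrightarrow>
     finite (verts T) \<and> verts T \<noteq> {} \<and>
     (\<forall>e\<in>edges T. e \<subseteq> verts T \<and> card e = 2) \<and>
     (\<forall>x\<in>verts T. \<forall>y\<in>verts T. \<exists>!p. is_path T x p y)"

definition degree :: "'v ltree \<Rightarrow> 'v \<Rightarrow> nat" where
  "degree T v = card {e \<in> edges T. v \<in> e}"

definition leaves :: "'v ltree \<Rightarrow> 'v set" where
  "leaves T = {v \<in> verts T. degree T v = 1}"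

definition internal_edges :: "'v ltree \<Rightarrow> 'v set set" where
  "internal_edges T = {e \<in> edges T. e \<inter> leaves T = {}}"

definition stable_tree :: "nat \<Rightarrow> 'v ltree \<Rightarrow> bool" where
  "stable_tree n T \<longleftrightarrow>
     is_tree T \<and> (\<forall>v\<in>verts T - leaves T. degree T v \<ge> 3) \<and>
     bij_betw (lab T) (leaves T) {label_a..int n}"


section \<open>Slide labelings\<close>

text \<open>
  The contraction of a set \<open>F\<close> of edges: its vertices are the classes of vertices of \<open>T\<close>
  joined by edges in \<open>F\<close>.  Only internal edges will be contracted, so the class of a leaf is
  the singleton of that leaf.
\<close>

definition block :: "'v ltree \<Rightarrow> 'v set set \<Rightarrow> 'v \<Rightarrow> 'v set" where
  "block T F x = {y. (x, y) \<in> {(u, v). {u, v} \<in> F}\<^sup>*}"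

definition contract :: "'v ltree \<Rightarrow> 'v set set \<Rightarrow> 'v set ltree" where
  "contract T F =
     \<lparr> verts = block T F ` verts T,
       edges = (\<lambda>e. block T F ` e) ` (edges T - F),
       lab = (\<lambda>X. lab T (the_elem X)) \<rparr>"

definition leaf_of :: "'v ltree \<Rightarrow> int \<Rightarrow> 'v" where
  "leaf_of T i = (THE x. x \<in> leaves T \<and> lab T x = i)"

definition path_between :: "'v ltree \<Rightarrow> 'v \<Rightarrow> 'v \<Rightarrow> 'v list" where
  "path_between T x y = (THE p. is_path T x p y)"

text \<open>The branches at \<open>v\<close>: the components left after removing \<open>v\<close>, one for each neighbour.\<close>

definition branches :: "'v ltree \<Rightarrow> 'v \<Rightarrow> 'v set set" where
  "branches T v = {{y. \<exists>p. is_path T x p y \<and> v \<notin> set p} | x. {v, x} \<in> edges T}"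

definition min_label :: "'v ltree \<Rightarrow> 'v \<Rightarrow> int \<Rightarrow> int" where
  "min_label T v l =
     Min (lab T ` {x \<in> leaves T. \<exists>B\<in>branches T v.
                      x \<in> B \<and> leaf_of T label_a \<notin> B \<and> leaf_of T l \<notin> B})"

text \<open>
  One step of the procedure, for the letter \<open>l\<close> and the current partial edge labelling \<open>L\<close>;
  the result is \<open>None\<close> on failure.  The first internal edge on the path is found as a pair
  \<open>(u, v)\<close> oriented along the path, so that \<open>u\<close> is the vertex adjacent to the leaf \<open>l\<close>.
  The edge to be labelled is the unlabelled edge of \<open>T\<close> that becomes \<open>{u, v}\<close> in the
  contraction.  The argument \<open>ok\<close> is the condition on \<open>l\<close>, \<open>m\<^sub>l\<close> and \<open>m\<^sub>a\<close>.
\<close>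

definition slide_step ::
  "(int \<Rightarrow> int \<Rightarrow> int \<Rightarrow> bool) \<Rightarrow> 'v ltree \<Rightarrow> nat \<Rightarrow> ('v set \<rightharpoonup> nat) \<Rightarrow> ('v set \<rightharpoonup> nat) option" where
  "slide_step ok T l L =
     (let T' = contract T (dom L);
          p = path_between T' (leaf_of T' (int l)) (leaf_of T' label_a)
      in case find (\<lambda>(u, v). {u, v} \<in> internal_edges T') (zip p (tl p)) of
           None \<Rightarrow> None
         | Some (u, v) \<Rightarrow>
             if ok (int l) (min_label T' u (int l)) (min_label T' v (int l))
             then Some (L((THE e. e \<in> edges T - dom L \<and> block T (dom L) ` e = {u, v}) \<mapsto> l))
             else None)"

primrec slide_run ::
  "(int \<Rightarrow> int \<Rightarrow> int \<Rightarrow> bool) \<Rightarrow> 'v ltree \<Rightarrow> nat list \<Rightarrow> ('v set \<rightharpoonup> nat) \<Rightarrow> ('v set \<rightharpoonup> nat) option" where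
  "slide_run ok T [] L = Some L"
| "slide_run ok T (l # ls) L =
     (case slide_step ok T l L of None \<Rightarrow> None | Some L' \<Rightarrow> slide_run ok T ls L')"

definition slide_labeling ::
  "(int \<Rightarrow> int \<Rightarrow> int \<Rightarrow> bool) \<Rightarrow> nat \<Rightarrow> (nat \<Rightarrow> nat) \<Rightarrow> 'v ltree \<Rightarrow> ('v set \<rightharpoonup> nat) option" where
  "slide_labeling ok n k T =
     slide_run ok T (concat (map (\<lambda>l. replicate (k l) l) (rev [1..<n+1]))) Map.empty"

definition psi_labeling :: "nat \<Rightarrow> (nat \<Rightarrow> nat) \<Rightarrow> 'v ltree \<Rightarrow> ('v set \<rightharpoonup> nat) option" where
  "psi_labeling = slide_labeling (\<lambda>l ml ma. ml \<ge> ma)"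

definition omega_labeling :: "nat \<Rightarrow> (nat \<Rightarrow> nat) \<Rightarrow> 'v ltree \<Rightarrow> ('v set \<rightharpoonup> nat) option" where
  "omega_labeling = slide_labeling (\<lambda>l ml ma. l \<ge> ml \<and> ml \<ge> ma)"

definition Slide_psi :: "nat \<Rightarrow> (nat \<Rightarrow> nat) \<Rightarrow> 'v ltree set" where
  "Slide_psi n k = {T. stable_tree n T \<and> psi_labeling n k T \<noteq> None}"

definition Slide_omega :: "nat \<Rightarrow> (nat \<Rightarrow> nat) \<Rightarrow> 'v ltree set" where
  "Slide_omega n k = {T. stable_tree n T \<and> omega_labeling n k T \<noteq> None}"


section \<open>The caterpillar tree of a word\<close>

text \<open>
  For a word of length \<open>n\<close>, the path is \<open>Spine 0, \<dots>, Spine n\<close> and the leaves are, from left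
  to right, \<open>Leg 0, \<dots>, Leg (n + 2)\<close>.  \<open>Leg 0\<close> and \<open>Leg 1\<close> are at the root \<open>Spine 0\<close>;
  \<open>Leg (t + 2)\<close> with \<open>t + 1 < n\<close> is the leaf between the letters \<open>w ! t\<close> and \<open>w ! (t + 1)\<close>;
  \<open>Leg (n + 1)\<close> and \<open>Leg (n + 2)\<close> are respectively the descent leaf and the nondescent leaf
  at the right end.
\<close>

datatype cvert = Spine nat | Leg nat

definition descent_labels :: "nat list \<Rightarrow> nat set" where
  "descent_labels w =
     {w ! t | t. t + 1 = length w \<or> (t + 1 < length w \<and> w ! t > w ! (t + 1))}"

text \<open>
  The labels of the leaves after the root, from left to right, where \<open>U\<close> is the set of
  remaining unused labels (the number 0 being the label \<open>c\<close>).
\<close>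

fun outer_labels :: "nat list \<Rightarrow> nat set \<Rightarrow> nat list" where
  "outer_labels [] U = []"
| "outer_labels [x] U = [x, Min U]"
| "outer_labels (x # y # w) U =
     (if x > y then x # outer_labels (y # w) U
      else let m = (if Min U = y then Min (U - {y}) else Min U)
           in m # outer_labels (y # w) (U - {m}))"

definition tree_labels :: "nat list \<Rightarrow> int list" where
  "tree_labels w =
     [label_a, label_b] @ map int (outer_labels w ({0..length w} - descent_labels w))"

definition spine_edge :: "nat \<Rightarrow> cvert set" where
  "spine_edge i = {Spine i, Spine (i + 1)}"

definition tree :: "nat list \<Rightarrow> cvert ltree" where
  "tree w =
     (let n = length w in
      \<lparr> verts = Spine ` {0..n} \<union> Leg ` {0..n+2},
        edges = spine_edge ` {0..<n} \<union> (\<lambda>j. {Leg j, Spine (min (j - 1) n)}) ` {0..n+2},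
        lab = (\<lambda>x. case x of Leg j \<Rightarrow> tree_labels w ! j | Spine _ \<Rightarrow> undefined) \<rparr>)"

definition reads :: "(cvert set \<rightharpoonup> nat) \<Rightarrow> nat list \<Rightarrow> bool" where
  "reads L w \<longleftrightarrow> (\<forall>i<length w. L (spine_edge i) = Some (w ! i))"

end

theory Submission
  imports Defs
begin

text \<open>
  Let \<open>n\<close> be the length of \<open>w\<close> and \<open>\<lambda>\<^sub>0, \<dots>, \<lambda>\<^sub>n\<close> the labels of the leaves of \<open>tree w\<close> after the
  root, so that \<open>\<lambda>\<^sub>t\<close> sits immediately to the right of the edge \<open>w ! t\<close> (and \<open>\<lambda>\<^sub>n\<close> is the
  rightmost leaf).

  \<^bold>\<open>Reduction to words.\<close>  Contracting spine edges of a caterpillar gives a caterpillar, so one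
  slide step depends only on the set of positions labelled so far: it labels the last unlabelled
  edge to the left of the leaf \<open>l\<close>, provided that the labels compare correctly.  A run that reads
  \<open>w\<close> must therefore label the positions by decreasing letter, and from right to left among equal
  letters, and it does so if and only if the labels \<open>\<lambda>\<close> form a permutation of \<open>0, \<dots>, n\<close> and
  every position \<open>p\<close> satisfies the local conditions \<open>slides\<close>: the leaf labelled \<open>w ! p\<close> lies to
  the right of \<open>p\<close> but before every smaller letter to the right of \<open>p\<close>; the smallest label right
  of \<open>p\<close> (other than \<open>w ! p\<close>) is beaten in the block just left of \<open>p\<close>; for \<open>\<omega>\<close>, some label right
  of \<open>p\<close> is smaller than \<open>w ! p\<close>.  This is \<open>slide_labeling_reads_iff\<close>.

  \<^bold>\<open>Necessity.\<close>  Under these conditions, the label of a nondescent leaf is smaller than all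
  labels to its right, except possibly that of the next edge (\<open>ascent_label_le\<close>).  Both pattern
  conditions follow, and so does the fact that every label \<open>j > i\<close> that is not a letter lies at or
  after the last group of \<open>i\<close>'s.  The inequality for \<open>\<psi>\<close> is then a count of the leaves from
  that group on, which also carry the label \<open>i\<close> and all letters after the last \<open>i\<close>.  For \<open>\<omega>\<close>,
  the labels \<open>j\<close> even lie after the last \<open>i\<close>, and the leaves there carry in addition more labels
  smaller than \<open>i\<close> than there are letters smaller than \<open>i\<close> (\<open>card_smaller_labels\<close>).

  \<^bold>\<open>Sufficiency.\<close>  Here the greedy choice of the nondescent labels is used.  If a nondescent
  leaf \<open>t\<close> received a label at least as large as a letter \<open>e\<close> whose last group starts after
  position \<open>t + 1\<close>, then all leaves from that group on would carry \<open>e\<close>, letters to the right of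
  the last \<open>e\<close>, or non-letters greater than \<open>e\<close> (\<open>labels_from_last_group\<close>).  In the cases of
  interest one of these labels is already used at \<open>t\<close>, and the assumed inequality for \<open>e\<close> then
  leaves too few of them.  This excludes both a leaf placed too far left and
  a violation of the comparison of labels.  The condition for \<open>\<omega>\<close> is one more count of this kind.
\<close>

section \<open>Paths and branches in caterpillars\<close>

lemma is_path_successively:
  "is_path T x p y \<longleftrightarrow> p \<noteq> [] \<and> hd p = x \<and> last p = y \<and> distinct p \<and> set p \<subseteq> verts T \<and>
     successively (\<lambda>u v. {u, v} \<in> edges T) p"
  unfolding is_path_def successively_conv_nth by simp

lemma is_path_rev: "is_path T x p y \<longleftrightarrow> is_path T y (rev p) x"
  unfolding is_path_successively
  by (auto simp: hd_rev last_rev successively_rev insert_commute)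

lemma path_between_eqI:
  assumes "is_tree T" "is_path T x p y"
  shows "path_between T x y = p"
proof -
  have "x \<in> verts T" "y \<in> verts T"
    using assms(2) unfolding is_path_def by (auto dest: hd_in_set last_in_set)
  then have "\<exists>!p. is_path T x p y"
    using assms(1) unfolding is_tree_def by blast
  then show ?thesis
    unfolding path_between_def using assms(2) by (auto intro: the1_equality)
qed

lemma ex_path_avoiding_iff:
  assumes "is_tree T" "is_path T x q y"
  shows "(\<exists>p. is_path T x p y \<and> v \<notin> set p) \<longleftrightarrow> v \<notin> set q"
  using path_between_eqI[OF assms] path_between_eqI[OF assms(1)] assms(2) by metis

text \<open>
  Adding a leaf to a tree gives a tree.  Every caterpillar arises in this way, which is how the
  uniqueness of paths is obtained.
\<close>

lemma is_tree_add_leaf: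
  assumes T: "is_tree T" and v: "v \<in> verts T" and u: "u \<notin> verts T"
    and vT': "verts T' = insert u (verts T)" and eT': "edges T' = insert {u, v} (edges T)"
  shows "is_tree T'"
proof -
  have eT: "\<And>e. e \<in> edges T \<Longrightarrow> e \<subseteq> verts T \<and> card e = 2"
    using T unfolding is_tree_def by blast
  have ex1: "\<exists>!p. is_path T x p y" if "x \<in> verts T" "y \<in> verts T" for x y
    using T that unfolding is_tree_def by blast
  have nbr: "z = v" if "{u, z} \<in> edges T'" for z
    using that eT[of "{u, z}"] u unfolding eT' by (auto simp: doubleton_eq_iff)
  have avoid: "u \<notin> set p" if p: "is_path T' x p y" and "x \<noteq> u" "y \<noteq> u" for x y p
  proof
    assume "u \<in> set p"
    then obtain xs ys where s: "p = xs @ u # ys" by (auto simp: in_set_conv_decomp)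
    have ne: "xs \<noteq> []" "ys \<noteq> []"
      using p that(2,3) unfolding s is_path_def by auto
    have "{u, last xs} \<in> edges T'" "{u, hd ys} \<in> edges T'"
      using p ne unfolding s is_path_successively
      by (auto simp: successively_append_iff successively_Cons insert_commute)
    then have "last xs = v" "hd ys = v" using nbr by auto
    moreover have "set xs \<inter> set ys = {}" using p unfolding s is_path_def by auto
    moreover have "last xs \<in> set xs" "hd ys \<in> set ys" using ne by auto
    ultimately show False by auto
  qed
  have old: "is_path T' x p y \<longleftrightarrow> is_path T x p y" if "x \<noteq> u" "y \<noteq> u" for x y p
  proof
    assume p: "is_path T' x p y"
    then have "u \<notin> set p" using avoid that by blast
    then show "is_path T x p y" using p unfolding is_path_def vT' eT'
      by (auto simp: doubleton_eq_iff)
  next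
    assume "is_path T x p y"
    then show "is_path T' x p y" unfolding is_path_def vT' eT' by auto
  qed
  have new: "is_path T' u p y \<longleftrightarrow> (\<exists>q. p = u # q \<and> is_path T v q y)" if "y \<noteq> u" for y p
  proof
    assume p: "is_path T' u p y"
    then obtain q where q: "p = u # q" unfolding is_path_def by (cases p) auto
    have "q \<noteq> []" using p that unfolding q is_path_def by auto
    then have "{u, hd q} \<in> edges T'"
      using p unfolding q is_path_successively by (auto simp: successively_Cons)
    then have "hd q = v" by (rule nbr)
    then have "is_path T' v q y" using p \<open>q \<noteq> []\<close> unfolding q is_path_successively
      by (auto simp: successively_Cons)
    then have "is_path T v q y" using old[of v y q] that v u by metis
    then show "\<exists>q. p = u # q \<and> is_path T v q y" using q by blast
  next
    assume "\<exists>q. p = u # q \<and> is_path T v q y"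
    then obtain q where q: "p = u # q" and "is_path T v q y" by blast
    have "v \<noteq> u" using u v by blast
    then have "is_path T' v q y" using old[OF _ that] \<open>is_path T v q y\<close> by blast
    moreover have "u \<notin> set q" using \<open>is_path T v q y\<close> u unfolding is_path_def by blast
    ultimately show "is_path T' u p y" unfolding q is_path_successively vT' eT'
      by (auto simp: successively_Cons)
  qed
  have new1: "\<exists>!p. is_path T' u p y" if y: "y \<in> verts T" for y
  proof -
    obtain q where q: "is_path T v q y" and q1: "\<And>q'. is_path T v q' y \<Longrightarrow> q' = q"
      using ex1[OF v y] by blast
    have "y \<noteq> u" using y u by blast
    show ?thesis
    proof (rule ex1I[of _ "u # q"])
      show "is_path T' u (u # q) y" using new[OF \<open>y \<noteq> u\<close>] q by blast
      show "p = u # q" if "is_path T' u p y" for p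
        using new[OF \<open>y \<noteq> u\<close>] q1 that by blast
    qed
  qed
  have uu: "is_path T' u p u \<longleftrightarrow> p = [u]" for p
  proof
    assume p: "is_path T' u p u"
    then obtain q where q: "p = u # q" unfolding is_path_def by (cases p) auto
    have "q = []" using p unfolding q is_path_def by (cases q rule: rev_cases) auto
    then show "p = [u]" using q by simp
  next
    assume "p = [u]" then show "is_path T' u p u" unfolding is_path_def vT' by auto
  qed
  have "\<exists>!p. is_path T' x p y" if x: "x \<in> verts T'" and y: "y \<in> verts T'" for x y
  proof (cases "x = u"; cases "y = u")
    assume "x \<noteq> u" "y \<noteq> u"
    then have "x \<in> verts T" "y \<in> verts T" using x y vT' by auto
    then show ?thesis unfolding old[OF \<open>x \<noteq> u\<close> \<open>y \<noteq> u\<close>] by (rule ex1)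
  next
    assume "x \<noteq> u" "y = u"
    then have "\<exists>!p. is_path T' u p x" using new1 x vT' by auto
    then obtain p where "is_path T' u p x" "\<And>q. is_path T' u q x \<Longrightarrow> q = p" by blast
    note p = this
    show ?thesis
    proof (rule ex1I[of _ "rev p"])
      show "is_path T' x (rev p) y" using p(1) is_path_rev[of T' x "rev p" y] \<open>y = u\<close> by simp
      show "q = rev p" if "is_path T' x q y" for q
        using p(2)[of "rev q"] is_path_rev[of T' x q y] that \<open>y = u\<close> by auto
    qed
  next
    assume "x = u" "y \<noteq> u"
    then show ?thesis using new1 y vT' by auto
  next
    assume "x = u" "y = u"
    then show ?thesis using uu by auto
  qed
  moreover have "card {u, v} = 2" using u v by (auto simp: card_insert_if)
  ultimately show ?thesis
    using T v unfolding is_tree_def[of T] by (subst is_tree_def) (simp add: vT' eT' subset_insertI2)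
qed

lemma is_tree_path_graph:
  fixes sp :: "nat \<Rightarrow> 'v"
  assumes "inj_on sp {0..m}"
  shows "is_tree \<lparr>verts = sp ` {0..m}, edges = (\<lambda>i. {sp i, sp (i + 1)}) ` {0..<m}, lab = f\<rparr>"
  using assms
proof (induction m)
  case 0
  have "p = [sp 0]" if "hd p = sp 0" "set p \<subseteq> {sp 0}" "distinct p" "p \<noteq> []" for p
    using that by (cases p; cases "tl p") auto
  then have "is_path \<lparr>verts = {sp 0}, edges = {}, lab = f\<rparr> (sp 0) p (sp 0) \<longleftrightarrow> p = [sp 0]" for p
    unfolding is_path_def by auto
  then show ?case by (auto simp: is_tree_def)
next
  case (Suc m)
  have "inj_on sp {0..m}" using Suc.prems by (auto simp: inj_on_def)
  note T = Suc.IH[OF this]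
  show ?case
  proof (rule is_tree_add_leaf[OF T, of "sp m" "sp (Suc m)"])
    show "sp (Suc m) \<notin> verts \<lparr>verts = sp ` {0..m}, edges = (\<lambda>i. {sp i, sp (i + 1)}) ` {0..<m}, lab = f\<rparr>"
      using Suc.prems by (force simp: inj_on_def)
  qed (auto simp: atLeast0_atMost_Suc atLeast0_lessThan_Suc insert_commute)
qed

lemma successively_upt: "successively P [i..<k] \<longleftrightarrow> (\<forall>l. i \<le> l \<and> Suc l < k \<longrightarrow> P l (Suc l))"
proof -
  have "successively P [i..<k] \<longleftrightarrow> (\<forall>a. Suc a < k - i \<longrightarrow> P (i + a) (Suc (i + a)))"
    unfolding successively_conv_nth by auto
  also have "\<dots> \<longleftrightarrow> (\<forall>l. i \<le> l \<and> Suc l < k \<longrightarrow> P l (Suc l))"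
  proof safe
    fix l assume "\<forall>a. Suc a < k - i \<longrightarrow> P (i + a) (Suc (i + a))" "i \<le> l" "Suc l < k"
    then show "P l (Suc l)" by (elim allE[of _ "l - i"]) auto
  qed auto
  finally show ?thesis .
qed

text \<open>
  A caterpillar with spine \<open>sp 0, \<dots>, sp m\<close> and leaves \<open>leg 0, \<dots>, leg N\<close>, the leaf \<open>leg j\<close> being
  attached to the spine vertex \<open>sp (att j)\<close>.  The conditions on \<open>att\<close> (two leaves at \<open>sp 0\<close>, at
  least one everywhere) ensure that no spine vertex is a leaf.  Both \<open>tree w\<close> and its contractions
  are instances, with \<open>leg 0\<close> as the leaf \<open>a\<close>.
\<close>

locale caterpillar =
  fixes T :: "'v ltree" and sp leg :: "nat \<Rightarrow> 'v" and att :: "nat \<Rightarrow> nat" and m N :: nat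
  assumes verts: "verts T = sp ` {0..m} \<union> leg ` {0..N}"
    and edges: "edges T = (\<lambda>i. {sp i, sp (i + 1)}) ` {0..<m} \<union> (\<lambda>j. {leg j, sp (att j)}) ` {0..N}"
    and inj_sp: "inj_on sp {0..m}" and inj_leg: "inj_on leg {0..N}"
    and disj: "\<And>i j. i \<le> m \<Longrightarrow> j \<le> N \<Longrightarrow> sp i \<noteq> leg j"
    and att_le: "\<And>j. j \<le> N \<Longrightarrow> att j \<le> m"
    and att0: "att 0 = 0" and att1: "att 1 = 0" and N_pos: "1 \<le> N"
    and att_surj: "\<And>i. i \<le> m \<Longrightarrow> \<exists>j\<le>N. att j = i"
begin

lemma sp_eq_iff: "i \<le> m \<Longrightarrow> i' \<le> m \<Longrightarrow> sp i = sp i' \<longleftrightarrow> i = i'"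
  using inj_sp by (auto simp: inj_on_def)

lemma leg_eq_iff: "j \<le> N \<Longrightarrow> j' \<le> N \<Longrightarrow> leg j = leg j' \<longleftrightarrow> j = j'"
  using inj_leg by (auto simp: inj_on_def)

lemma is_tree: "is_tree T"
proof -
  have "is_tree \<lparr>verts = sp ` {0..m} \<union> leg ` {0..<M},
      edges = (\<lambda>i. {sp i, sp (i + 1)}) ` {0..<m} \<union> (\<lambda>j. {leg j, sp (att j)}) ` {0..<M}, lab = lab T\<rparr>"
    if "M \<le> Suc N" for M
    using that
  proof (induction M)
    case 0
    then show ?case using is_tree_path_graph[OF inj_sp] by simp
  next
    case (Suc M)
    then have "M \<le> N" by simp
    have "M \<le> Suc N" using Suc.prems by simp
    note IH = Suc.IH[OF this]
    have *: "leg M \<noteq> leg j" if "j < M" for j using leg_eq_iff[of M j] that \<open>M \<le> N\<close> by auto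
    have **: "leg M \<noteq> sp i" if "i \<le> m" for i using disj[of i M] that \<open>M \<le> N\<close> by auto
    show ?case
      by (rule is_tree_add_leaf[OF IH, of "sp (att M)" "leg M"])
        (use * ** att_le[OF \<open>M \<le> N\<close>] in \<open>auto simp: atLeast0_lessThan_Suc image_iff\<close>)
  qed
  from this[of "Suc N"] show ?thesis
    unfolding is_tree_def is_path_def
    by (simp add: verts edges atLeastLessThanSuc_atLeastAtMost)
qed

lemma edge_sp: "i < m \<Longrightarrow> {sp i, sp (Suc i)} \<in> edges T"
  unfolding edges by auto

lemma edge_leg: "j \<le> N \<Longrightarrow> {leg j, sp (att j)} \<in> edges T"
  unfolding edges by auto

lemma edge_sp_iff:
  assumes "k \<le> m"
  shows "{sp k, x} \<in> edges T \<longleftrightarrow>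
    (\<exists>j\<le>N. att j = k \<and> x = leg j) \<or> (k > 0 \<and> x = sp (k - 1)) \<or> (k < m \<and> x = sp (k + 1))"
proof
  assume "{sp k, x} \<in> edges T"
  then consider i where "i < m" "{sp k, x} = {sp i, sp (i + 1)}"
    | j where "j \<le> N" "{sp k, x} = {leg j, sp (att j)}" unfolding edges by auto
  then show "(\<exists>j\<le>N. att j = k \<and> x = leg j) \<or> (k > 0 \<and> x = sp (k - 1)) \<or> (k < m \<and> x = sp (k + 1))"
  proof cases
    case 1
    then have "sp k = sp i \<and> x = sp (i + 1) \<or> sp k = sp (i + 1) \<and> x = sp i"
      by (auto simp: doubleton_eq_iff)
    then show ?thesis using 1(1) assms sp_eq_iff[of k i] sp_eq_iff[of k "i + 1"] by auto
  next
    case 2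
    then have "x = leg j \<and> sp k = sp (att j)"
      using disj[OF assms 2(1)] by (auto simp: doubleton_eq_iff)
    then show ?thesis using 2(1) assms sp_eq_iff[of k "att j"] att_le by auto
  qed
next
  assume "(\<exists>j\<le>N. att j = k \<and> x = leg j) \<or> (k > 0 \<and> x = sp (k - 1)) \<or> (k < m \<and> x = sp (k + 1))"
  then show "{sp k, x} \<in> edges T"
    using edge_leg edge_sp[of "k - 1"] edge_sp[of k] assms by (auto simp: insert_commute)
qed

lemma leaves: "leaves T = leg ` {0..N}"
proof -
  have "degree T (leg j) = 1" if "j \<le> N" for j
  proof -
    have "{e \<in> edges T. leg j \<in> e} = {{leg j, sp (att j)}}"
      using that disj disj[OF att_le] leg_eq_iff[OF that]
      by (fastforce simp: edges)
    then show ?thesis unfolding degree_def by simp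
  qed
  moreover have "degree T (sp k) \<noteq> 1" if k: "k \<le> m" for k
  proof -
    have "\<exists>e e'. e \<noteq> e' \<and> e \<in> edges T \<and> e' \<in> edges T \<and> sp k \<in> e \<and> sp k \<in> e'"
    proof (cases "k = 0")
      case True
      have "{leg 0, sp 0} \<noteq> {leg 1, sp 0}"
        using leg_eq_iff[of 0 1] disj[of 0 0] disj[of 0 1] N_pos by (auto simp: doubleton_eq_iff)
      then show ?thesis
        using edge_leg[of 0] edge_leg[of 1] att0 att1 N_pos True by (metis insertCI le0)
    next
      case False
      obtain j where j: "j \<le> N" "att j = k" using att_surj[OF k] by auto
      have "{leg j, sp k} \<noteq> {sp (k - 1), sp k}"
        using disj[OF k j(1)] disj[OF le_trans[OF diff_le_self k] j(1), of 1]
        by (auto simp: doubleton_eq_iff)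
      then show ?thesis
        using edge_leg[of j] edge_sp[of "k - 1"] False k j
        by (intro exI[of _ "{leg j, sp k}"] exI[of _ "{sp (k - 1), sp k}"]) auto
    qed
    then obtain e e' where "e \<noteq> e'" "{e, e'} \<subseteq> {e \<in> edges T. sp k \<in> e}" by auto
    moreover have "finite {e \<in> edges T. sp k \<in> e}" unfolding edges by auto
    ultimately have "card {e, e'} \<le> degree T (sp k)" unfolding degree_def by (metis card_mono)
    then show ?thesis using \<open>e \<noteq> e'\<close> by auto
  qed
  ultimately show ?thesis unfolding leaves_def verts by auto
qed

lemma internal_edges: "internal_edges T = (\<lambda>i. {sp i, sp (i + 1)}) ` {0..<m}"
proof -
  have "{sp i, sp (i + 1)} \<inter> leg ` {0..N} = {}" if "i < m" for i
    using disj[of i] disj[of "i + 1"] that by fastforce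
  then have spine: "\<forall>e\<in>(\<lambda>i. {sp i, sp (i + 1)}) ` {0..<m}. e \<inter> leg ` {0..N} = {}"
    by (simp del: Int_insert_left)
  have legs: "\<forall>e\<in>(\<lambda>j. {leg j, sp (att j)}) ` {0..N}. e \<inter> leg ` {0..N} \<noteq> {}"
    by auto
  have split: "{e \<in> A \<union> B. e \<inter> L = {}} = A"
    if "\<forall>e\<in>A. e \<inter> L = {}" "\<forall>e\<in>B. e \<inter> L \<noteq> {}" for A B :: "'v set set" and L
    using that by auto
  show ?thesis unfolding internal_edges_def leaves edges by (rule split[OF spine legs])
qed

text \<open>The spine vertices from position \<open>i\<close> to position \<open>k\<close>, in either direction.\<close>

definition spine_path :: "nat \<Rightarrow> nat \<Rightarrow> 'v list" where
  "spine_path i k = map sp (if i \<le> k then [i..<k + 1] else rev [k..<i + 1])"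

lemma spine_path_set: "set (spine_path i k) = sp ` {min i k..max i k}"
  unfolding spine_path_def by (auto simp del: upt_Suc simp: atLeastLessThanSuc_atLeastAtMost)

lemma spine_path_ne: "spine_path i k \<noteq> []" "hd (spine_path i k) = sp i" "last (spine_path i k) = sp k"
  unfolding spine_path_def by (auto simp: hd_map last_map hd_rev last_rev simp del: upt_Suc)

lemma spine_path_is_path:
  assumes "i \<le> m" "k \<le> m"
  shows "is_path T (sp i) (spine_path i k) (sp k)"
proof -
  have "distinct (spine_path i k)"
  proof -
    have "inj_on sp {i..<k + 1}" "inj_on sp {k..<i + 1}"
      using assms by (auto intro!: inj_on_subset[OF inj_sp])
    then show ?thesis unfolding spine_path_def
      by (simp add: distinct_map del: upt_Suc)
  qed
  moreover have "set (spine_path i k) \<subseteq> verts T"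
    unfolding spine_path_set verts using assms by force
  moreover have "successively (\<lambda>u v. {u, v} \<in> edges T) (spine_path i k)"
    unfolding spine_path_def successively_map using edge_sp assms
    by (auto simp: successively_upt successively_rev successively_map insert_commute simp del: upt_Suc)
  ultimately show ?thesis using spine_path_ne unfolding is_path_successively by auto
qed

lemma spine_leg_path:
  assumes "i \<le> m" "j \<le> N"
  shows "is_path T (sp i) (spine_path i (att j) @ [leg j]) (leg j)"
proof -
  have "leg j \<notin> set (spine_path i (att j))"
  proof
    assume "leg j \<in> set (spine_path i (att j))"
    then obtain k where "k \<le> max i (att j)" "leg j = sp k" unfolding spine_path_set by auto
    moreover have "max i (att j) \<le> m" using assms att_le by simp
    ultimately show False using disj[OF le_trans assms(2)] by metis
  qed
  moreover have "leg j \<in> verts T" using assms verts by auto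
  ultimately show ?thesis
    using spine_path_is_path[OF assms(1) att_le[OF assms(2)]] spine_path_ne[of i "att j"] edge_leg[OF assms(2)]
    unfolding is_path_successively by (auto simp: successively_append_iff insert_commute)
qed

lemma leg_leg_path:
  assumes "i \<le> N" "j \<le> N" "i \<noteq> j"
  shows "is_path T (leg i) (leg i # spine_path (att i) (att j) @ [leg j]) (leg j)"
proof -
  have "leg i \<notin> set (spine_path (att i) (att j) @ [leg j])"
  proof
    assume "leg i \<in> set (spine_path (att i) (att j) @ [leg j])"
    then obtain k where "k \<le> max (att i) (att j)" "leg i = sp k"
      using leg_eq_iff[OF assms(1,2)] assms(3) unfolding spine_path_set set_append by auto
    moreover have "max (att i) (att j) \<le> m" using assms att_le by simp
    ultimately show False using disj[OF le_trans assms(1)] by metis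
  qed
  moreover have "leg i \<in> verts T" using assms verts by auto
  ultimately show ?thesis
    using spine_leg_path[OF att_le[OF assms(1)] assms(2)] edge_leg[OF assms(1)]
      spine_path_ne[of "att i" "att j"]
    unfolding is_path_successively by (auto simp: successively_Cons)
qed

lemma avoiding_spine_iff:
  assumes "i \<le> m" "j \<le> N" "k \<le> m"
  shows "(\<exists>p. is_path T (sp i) p (leg j) \<and> sp k \<notin> set p) \<longleftrightarrow> k < min i (att j) \<or> max i (att j) < k"
proof -
  have "sp k \<notin> set (spine_path i (att j) @ [leg j]) \<longleftrightarrow> k < min i (att j) \<or> max i (att j) < k"
  proof -
    have "sp k \<in> sp ` {min i (att j)..max i (att j)} \<longleftrightarrow> k \<in> {min i (att j)..max i (att j)}"
      using assms att_le[of j] by (intro inj_on_image_mem_iff[OF inj_sp]) auto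
    then show ?thesis using disj[OF assms(3,2)] by (auto simp: spine_path_set)
  qed
  then show ?thesis using ex_path_avoiding_iff[OF is_tree spine_leg_path[OF assms(1,2)]] by simp
qed

lemma avoiding_leg_iff:
  assumes "i \<le> N" "j \<le> N" "att i = k"
  shows "(\<exists>p. is_path T (leg i) p (leg j) \<and> sp k \<notin> set p) \<longleftrightarrow> i = j"
proof (cases "i = j")
  case True
  have "is_path T (leg i) [leg i] (leg i)" "sp k \<notin> set [leg i]"
    using assms disj[of k i] att_le[of i] verts by (auto simp: is_path_def)
  then show ?thesis using True by blast
next
  case False
  then show ?thesis
    using ex_path_avoiding_iff[OF is_tree leg_leg_path[OF assms(1,2) False]] assms(3)
    by (auto simp: spine_path_set)
qed

text \<open>
  When the leaf \<open>leg j\<close> lies in a branch at \<open>sp k\<close> that contains neither \<open>leg a\<close> nor \<open>leg l\<close>: it is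
  attached at \<open>sp k\<close> itself, or it lies on a side of \<open>sp k\<close> on which neither of them lies.
\<close>

lemma branches_legs:
  assumes "k \<le> m" and that: "j \<le> N" "a \<le> N" "l \<le> N"
  shows "(\<exists>B\<in>branches T (sp k). leg j \<in> B \<and> leg a \<notin> B \<and> leg l \<notin> B) \<longleftrightarrow>
    (att j = k \<and> j \<noteq> a \<and> j \<noteq> l) \<or> (att j < k \<and> att a \<ge> k \<and> att l \<ge> k)
      \<or> (att j > k \<and> att a \<le> k \<and> att l \<le> k)"
proof -
  let ?R = "\<lambda>x y. \<exists>p. is_path T x p y \<and> sp k \<notin> set p"
  have "(\<exists>B\<in>branches T (sp k). leg j \<in> B \<and> leg a \<notin> B \<and> leg l \<notin> B) \<longleftrightarrow>
    (\<exists>x. {sp k, x} \<in> edges T \<and> ?R x (leg j) \<and> \<not> ?R x (leg a) \<and> \<not> ?R x (leg l))"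
  proof -
    have "(\<exists>B\<in>{f x | x. P x}. Q B) \<longleftrightarrow> (\<exists>x. P x \<and> Q (f x))"
      for f :: "'v \<Rightarrow> 'v set" and P Q by auto
    then show ?thesis unfolding branches_def by simp
  qed
  also have "\<dots> \<longleftrightarrow> (\<exists>i\<le>N. att i = k \<and> ?R (leg i) (leg j) \<and> \<not> ?R (leg i) (leg a) \<and> \<not> ?R (leg i) (leg l))
     \<or> (k > 0 \<and> ?R (sp (k - 1)) (leg j) \<and> \<not> ?R (sp (k - 1)) (leg a) \<and> \<not> ?R (sp (k - 1)) (leg l))
     \<or> (k < m \<and> ?R (sp (k + 1)) (leg j) \<and> \<not> ?R (sp (k + 1)) (leg a) \<and> \<not> ?R (sp (k + 1)) (leg l))"
    unfolding edge_sp_iff[OF assms(1)] by blast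
  also have "\<dots> \<longleftrightarrow> (\<exists>i\<le>N. att i = k \<and> i = j \<and> i \<noteq> a \<and> i \<noteq> l)
     \<or> (k > 0 \<and> att j < k \<and> \<not> att a < k \<and> \<not> att l < k)
     \<or> (k < m \<and> att j > k \<and> \<not> att a > k \<and> \<not> att l > k)"
  proof -
    have 1: "(\<exists>i\<le>N. att i = k \<and> ?R (leg i) (leg j) \<and> \<not> ?R (leg i) (leg a) \<and> \<not> ?R (leg i) (leg l))
      \<longleftrightarrow> (\<exists>i\<le>N. att i = k \<and> i = j \<and> i \<noteq> a \<and> i \<noteq> l)"
      using avoiding_leg_iff that by (intro ex_cong) blast
    have 2: "?R (sp (k - 1)) (leg j') \<longleftrightarrow> att j' < k" if "k > 0" "j' \<le> N" for j'
      using avoiding_spine_iff[of "k - 1" j' k] assms(1) that by auto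
    have 3: "?R (sp (k + 1)) (leg j') \<longleftrightarrow> att j' > k" if "k < m" "j' \<le> N" for j'
      using avoiding_spine_iff[of "k + 1" j' k] assms(1) that by auto
    show ?thesis unfolding 1 using 2[OF _ that(1)] 2[OF _ that(2)] 2[OF _ that(3)]
       3[OF _ that(1)] 3[OF _ that(2)] 3[OF _ that(3)] by blast
  qed
  also have "\<dots> \<longleftrightarrow> (att j = k \<and> j \<noteq> a \<and> j \<noteq> l) \<or> (att j < k \<and> att a \<ge> k \<and> att l \<ge> k)
      \<or> (att j > k \<and> att a \<le> k \<and> att l \<le> k)"
    using that att_le[of j] by auto
  finally show ?thesis .
qed

lemma leaf_of:
  assumes "inj_on (\<lambda>j. lab T (leg j)) {0..N}" "j \<le> N" "lab T (leg j) = i"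
  shows "leaf_of T i = leg j"
  unfolding leaf_of_def leaves
  using assms by (intro the_equality) (auto simp: inj_on_def)

text \<open>
  The two minima compared by a slide of the leaf \<open>leg l\<close>: they range over the leaves at the left
  end \<open>sp k\<close> of the edge, and over all leaves other than \<open>leg l\<close> to the right of the edge.
\<close>

lemma min_label:
  assumes inj: "inj_on (\<lambda>j. lab T (leg j)) {0..N}" and lab0: "lab T (leg 0) = label_a"
    and l: "l \<le> N" "att l > k" "lab T (leg l) = i"
  shows "min_label T (sp k) i = Min ((\<lambda>j. lab T (leg j)) ` {j. 1 \<le> j \<and> j \<le> N \<and> att j = k})"
    and "att l = Suc k \<Longrightarrow>
      min_label T (sp (Suc k)) i = Min ((\<lambda>j. lab T (leg j)) ` {j. j \<le> N \<and> j \<noteq> l \<and> att j > k})"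
proof -
  have a: "leaf_of T label_a = leg 0" using leaf_of[OF inj _ lab0] by simp
  have b: "leaf_of T i = leg l" using leaf_of[OF inj l(1,3)] by simp
  have *: "{x \<in> leaves T. \<exists>B\<in>branches T (sp k'). x \<in> B \<and> leg 0 \<notin> B \<and> leg l \<notin> B} =
    leg ` {j. j \<le> N \<and> (att j = k' \<and> j \<noteq> 0 \<and> j \<noteq> l \<or> att j < k' \<and> k' \<le> att 0 \<and> k' \<le> att l
      \<or> k' < att j \<and> att 0 \<le> k' \<and> att l \<le> k')}" if "k' \<le> m" for k'
    unfolding leaves using branches_legs[OF that _ _ l(1), of _ 0] by fastforce
  have m: "k < m" using att_le[OF l(1)] l(2) by simp
  have "{j. j \<le> N \<and> (att j = k \<and> j \<noteq> 0 \<and> j \<noteq> l \<or> att j < k \<and> k \<le> att 0 \<and> k \<le> att l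
      \<or> k < att j \<and> att 0 \<le> k \<and> att l \<le> k)} = {j. 1 \<le> j \<and> j \<le> N \<and> att j = k}"
    using l att0 by auto
  then show "min_label T (sp k) i = Min ((\<lambda>j. lab T (leg j)) ` {j. 1 \<le> j \<and> j \<le> N \<and> att j = k})"
    unfolding min_label_def a b using *[of k] m by (simp add: image_image)
  assume "att l = Suc k"
  then have "{j. j \<le> N \<and> (att j = Suc k \<and> j \<noteq> 0 \<and> j \<noteq> l \<or> att j < Suc k \<and> Suc k \<le> att 0 \<and> Suc k \<le> att l
      \<or> Suc k < att j \<and> att 0 \<le> Suc k \<and> att l \<le> Suc k)} = {j. j \<le> N \<and> j \<noteq> l \<and> att j > k}"
    using att0 by (auto simp: Suc_lessI intro!: gr0I)
  then show "min_label T (sp (Suc k)) i = Min ((\<lambda>j. lab T (leg j)) ` {j. j \<le> N \<and> j \<noteq> l \<and> att j > k})"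
    unfolding min_label_def a b using *[of "Suc k"] m by (simp add: image_image)
qed

lemma find_first_internal_edge:
  assumes "l \<le> N" "l \<noteq> 0"
  shows "(let p = path_between T (leg l) (leg 0) in
      find (\<lambda>(u, v). {u, v} \<in> internal_edges T) (zip p (tl p))) =
    (if att l = 0 then None else Some (sp (att l), sp (att l - 1)))"
proof -
  let ?k = "att l"
  have p: "path_between T (leg l) (leg 0) = leg l # spine_path ?k 0 @ [leg 0]"
    using path_between_eqI[OF is_tree leg_leg_path[OF assms(1) _ assms(2)]] att0 by simp
  have nle: "{leg j, x} \<notin> internal_edges T" if "j \<le> N" for j x
    using that unfolding internal_edges_def leaves by auto
  show ?thesis
  proof (cases ?k)
    case 0
    then show ?thesis using nle[OF assms(1)] nle[of 0 "sp 0"]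
      unfolding p by (auto simp: spine_path_def insert_commute)
  next
    case (Suc k)
    then have "k < m" using att_le[OF assms(1)] by simp
    then have int: "{sp (Suc k), sp k} \<in> internal_edges T"
      unfolding internal_edges by (auto simp: insert_commute)
    have "spine_path ?k 0 = sp (Suc k) # sp k # map sp (rev [0..<k])"
      unfolding spine_path_def Suc by simp
    then show ?thesis unfolding p using nle[OF assms(1)] int Suc by auto
  qed
qed

end

section \<open>Contractions of the tree of a word\<close>

lemma spine_edge_eq_iff: "spine_edge i = spine_edge j \<longleftrightarrow> i = j"
  by (auto simp: spine_edge_def doubleton_eq_iff)

lemma tree_simps:
  "verts (tree w) = Spine ` {0..length w} \<union> Leg ` {0..length w + 2}"
  "edges (tree w) = (\<lambda>i. {Spine i, Spine (i + 1)}) ` {0..<length w}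
     \<union> (\<lambda>j. {Leg j, Spine (min (j - 1) (length w))}) ` {0..length w + 2}"
  "lab (tree w) (Leg j) = tree_labels w ! j"
  unfolding tree_def Let_def spine_edge_def by simp_all

lemma tree_caterpillar:
  "caterpillar (tree w) Spine Leg (\<lambda>j. min (j - 1) (length w)) (length w) (length w + 2)"
proof
  fix i assume "i \<le> length w"
  then show "\<exists>j\<le>length w + 2. min (j - 1) (length w) = i" by (intro exI[of _ "i + 1"]) auto
qed (auto simp: tree_simps inj_on_def)

text \<open>
  The contraction of \<open>tree w\<close> along the spine edges at the positions in \<open>X\<close>.
\<close>

locale contracted_caterpillar =
  fixes w :: "nat list" and X :: "nat set" and n :: nat
  defines "n \<equiv> length w"
  assumes X: "X \<subseteq> {0..<n}"
begin

text \<open>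
  The index of the block of \<open>Spine i\<close> along the contracted spine: the number of uncontracted edges
  to the left of \<open>Spine i\<close>.
\<close>

definition pos :: "nat \<Rightarrow> nat" where
  "pos i = card ({0..<i} - X)"

lemma pos_0: "pos 0 = 0"
  by (simp add: pos_def)

lemma pos_Suc: "pos (Suc i) = (if i \<in> X then pos i else Suc (pos i))"
proof -
  have "{0..<Suc i} - X = (if i \<in> X then {0..<i} - X else insert i ({0..<i} - X))"
    by (auto simp: less_Suc_eq)
  then show ?thesis by (simp add: pos_def)
qed

lemma pos_mono: "i \<le> i' \<Longrightarrow> pos i \<le> pos i'"
  unfolding pos_def by (intro card_mono) auto

lemma pos_less: "t \<notin> X \<Longrightarrow> t < i \<Longrightarrow> pos t < pos i"
  using pos_mono[of "Suc t" i] pos_Suc[of t] by simp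

lemma pos_eqI: "t \<le> i \<Longrightarrow> (\<And>s. t \<le> s \<Longrightarrow> s < i \<Longrightarrow> s \<in> X) \<Longrightarrow> pos i = pos t"
  by (induction i rule: dec_induct) (auto simp: pos_Suc)

lemma ex_edge_pos: "k < pos i \<Longrightarrow> \<exists>t<i. t \<notin> X \<and> pos t = k"
proof (induction i)
  case (Suc i)
  then show ?case
    by (cases "k < pos i") (auto simp: pos_Suc less_Suc_eq split: if_splits)
qed (simp add: pos_0)

lemma ex_pos: "k \<le> pos n \<Longrightarrow> \<exists>i\<le>n. pos i = k"
  using ex_edge_pos[of k n] by (metis le_eq_less_or_eq)

lemma pos_less_iff: "t \<notin> X \<Longrightarrow> pos t < pos i \<longleftrightarrow> t < i"
  using pos_less pos_mono[of i t] by (metis leD not_le)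

lemma pos_eq_iff: "t \<notin> X \<Longrightarrow> t' \<notin> X \<Longrightarrow> pos t = pos t' \<longleftrightarrow> t = t'"
  using pos_less by (metis less_irrefl nat_neq_iff)

text \<open>
  The \<open>k\<close>-th vertex of the contracted spine, as a set of vertices of \<open>tree w\<close>.
\<close>

definition spine_block :: "nat \<Rightarrow> cvert set" where
  "spine_block k = {Spine i | i. i \<le> n \<and> pos i = k}"

lemma edge_in_X: "{Spine i, y} \<in> spine_edge ` X \<longleftrightarrow>
    y = Spine (Suc i) \<and> i \<in> X \<or> (\<exists>i'. i = Suc i' \<and> y = Spine i' \<and> i' \<in> X)"
  by (auto simp: spine_edge_def doubleton_eq_iff)

lemma block_Leg: "block (tree w) (spine_edge ` X) (Leg j) = {Leg j}"
proof -
  have "y = Leg j" if "(Leg j, y) \<in> {(u, v). {u, v} \<in> spine_edge ` X}\<^sup>*" for y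
    using that by (induction rule: rtrancl_induct) (auto simp: spine_edge_def doubleton_eq_iff)
  then show ?thesis unfolding block_def by auto
qed

lemma block_Spine:
  assumes "i \<le> n"
  shows "block (tree w) (spine_edge ` X) (Spine i) = spine_block (pos i)"
proof -
  let ?R = "{(u, v). {u, v} \<in> spine_edge ` X}"
  have "\<exists>i'\<le>n. y = Spine i' \<and> pos i' = pos i" if "(Spine i, y) \<in> ?R\<^sup>*" for y
    using that
  proof (induction rule: rtrancl_induct)
    case (step y z)
    then obtain i' where i': "i' \<le> n" "y = Spine i'" "pos i' = pos i" by blast
    have "{Spine i', z} \<in> spine_edge ` X" using step(2) i' by simp
    then show ?case using i' X unfolding edge_in_X by (auto simp: pos_Suc)
  qed (use assms in simp)
  moreover
  have up: "(Spine t, Spine i') \<in> ?R\<^sup>*" if "t \<le> i'" "pos t = pos i'" for t i'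
    using that
  proof (induction i' rule: dec_induct)
    case (step i')
    have "i' \<in> X" "pos t = pos i'"
      using step pos_mono[of t i'] by (auto simp: pos_Suc split: if_splits)
    then have "(Spine i', Spine (Suc i')) \<in> ?R" using edge_in_X[of i'] by simp
    then show ?case using step \<open>pos t = pos i'\<close> by (meson rtrancl.rtrancl_into_rtrancl)
  qed simp
  have "sym ?R" by (auto simp: sym_def insert_commute)
  then have "sym (?R\<^sup>*)" by (rule sym_rtrancl)
  then have "(Spine i, Spine i') \<in> ?R\<^sup>*" if "pos i' = pos i" for i'
    using up[of i i'] up[of i' i] that by (cases "i \<le> i'") (auto dest: symD)
  ultimately show ?thesis unfolding block_def spine_block_def by fastforce
qed

lemma spine_block_eq_iff:
  assumes "k \<le> pos n"
  shows "spine_block k = spine_block k' \<longleftrightarrow> k = k'"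
proof -
  have "\<exists>i\<le>n. pos i = k" using assms by (rule ex_pos)
  then show ?thesis unfolding spine_block_def by auto
qed

abbreviation T' :: "cvert set ltree" where
  "T' \<equiv> contract (tree w) (spine_edge ` X)"

lemma block_spine_edge:
  assumes "t < n" "t \<notin> X"
  shows "block (tree w) (spine_edge ` X) ` spine_edge t = {spine_block (pos t), spine_block (pos t + 1)}"
proof -
  have "spine_edge t = {Spine t, Spine (Suc t)}" by (simp add: spine_edge_def)
  then show ?thesis using assms by (simp add: block_Spine pos_Suc)
qed

lemma block_leg_edge:
  "block (tree w) (spine_edge ` X) ` {Leg j, Spine (min (j - 1) n)}
     = {{Leg j}, spine_block (pos (min (j - 1) n))}"
  by (simp add: block_Leg block_Spine)

lemma edges_minus:
  "edges (tree w) - spine_edge ` X = spine_edge ` ({0..<n} - X)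
     \<union> (\<lambda>j. {Leg j, Spine (min (j - 1) n)}) ` {0..n + 2}"
proof -
  have "spine_edge ` {0..<n} - spine_edge ` X = spine_edge ` ({0..<n} - X)"
    by (intro image_set_diff[symmetric]) (simp add: inj_def spine_edge_eq_iff)
  moreover have "(\<lambda>j. {Leg j, Spine (min (j - 1) n)}) ` {0..n + 2} \<inter> spine_edge ` X = {}"
    by (auto simp: spine_edge_def doubleton_eq_iff)
  moreover have "edges (tree w) = spine_edge ` {0..<n}
      \<union> (\<lambda>j. {Leg j, Spine (min (j - 1) n)}) ` {0..n + 2}"
    by (simp add: tree_simps spine_edge_def n_def)
  ultimately show ?thesis by (simp add: Un_Diff Diff_triv)
qed

lemma contract_verts: "verts T' = spine_block ` {0..pos n} \<union> (\<lambda>j. {Leg j}) ` {0..n + 2}"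
proof -
  have "verts T' = (\<lambda>i. spine_block (pos i)) ` {0..n} \<union> (\<lambda>j. {Leg j}) ` {0..n + 2}"
    unfolding contract_def tree_simps n_def[symmetric]
    by (auto simp: image_Un image_image block_Spine block_Leg)
  also have "(\<lambda>i. spine_block (pos i)) ` {0..n} = spine_block ` pos ` {0..n}" by (simp add: image_image)
  also have "pos ` {0..n} = {0..pos n}"
    using pos_mono ex_pos by fastforce
  finally show ?thesis .
qed

lemma contract_edges: "edges T' = (\<lambda>k. {spine_block k, spine_block (k + 1)}) ` {0..<pos n}
     \<union> (\<lambda>j. {{Leg j}, spine_block (pos (min (j - 1) n))}) ` {0..n + 2}"
proof -
  have "edges T' = (\<lambda>t. {spine_block (pos t), spine_block (pos t + 1)}) ` ({0..<n} - X)
     \<union> (\<lambda>j. {{Leg j}, spine_block (pos (min (j - 1) n))}) ` {0..n + 2}"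
  proof -
    have "edges T' = (\<lambda>t. block (tree w) (spine_edge ` X) ` spine_edge t) ` ({0..<n} - X)
       \<union> (\<lambda>j. block (tree w) (spine_edge ` X) ` {Leg j, Spine (min (j - 1) n)}) ` {0..n + 2}"
      unfolding contract_def by (simp only: edges_minus image_Un image_image ltree.simps)
    moreover have "(\<lambda>t. block (tree w) (spine_edge ` X) ` spine_edge t) ` ({0..<n} - X)
       = (\<lambda>t. {spine_block (pos t), spine_block (pos t + 1)}) ` ({0..<n} - X)"
      by (intro image_cong refl block_spine_edge) auto
    ultimately show ?thesis unfolding block_leg_edge by simp
  qed
  also have "(\<lambda>t. {spine_block (pos t), spine_block (pos t + 1)}) ` ({0..<n} - X)
     = (\<lambda>k. {spine_block k, spine_block (k + 1)}) ` pos ` ({0..<n} - X)" by (simp add: image_image)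
  also have "pos ` ({0..<n} - X) = {0..<pos n}"
    using ex_edge_pos[of _ n] pos_less[of _ n] by force
  finally show ?thesis .
qed

lemma contract_caterpillar:
  "caterpillar T' spine_block (\<lambda>j. {Leg j}) (\<lambda>j. pos (min (j - 1) n)) (pos n) (n + 2)"
proof
  show "inj_on spine_block {0..pos n}" using spine_block_eq_iff by (auto simp: inj_on_def)
  fix i assume "i \<le> pos n"
  then obtain t where "t \<le> n" "pos t = i" using ex_pos by blast
  then show "\<exists>j\<le>n + 2. pos (min (j - 1) n) = i" by (intro exI[of _ "t + 1"]) auto
qed (auto simp: contract_verts contract_edges pos_0 spine_block_def inj_on_def intro: pos_mono)

sublocale C: caterpillar T' spine_block "\<lambda>j. {Leg j}" "\<lambda>j. pos (min (j - 1) n)" "pos n" "n + 2"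
  by (rule contract_caterpillar)

lemma contract_lab: "lab T' {Leg j} = tree_labels w ! j"
  by (simp add: contract_def tree_simps)

lemma the_edge:
  assumes "t < n" "t \<notin> X"
  shows "(THE e. e \<in> edges (tree w) - spine_edge ` X \<and>
     block (tree w) (spine_edge ` X) ` e = {spine_block (Suc (pos t)), spine_block (pos t)}) = spine_edge t"
proof (rule the_equality)
  show "spine_edge t \<in> edges (tree w) - spine_edge ` X \<and>
     block (tree w) (spine_edge ` X) ` spine_edge t = {spine_block (Suc (pos t)), spine_block (pos t)}"
    using assms by (auto simp: edges_minus block_spine_edge)
next
  fix e assume e: "e \<in> edges (tree w) - spine_edge ` X \<and>
     block (tree w) (spine_edge ` X) ` e = {spine_block (Suc (pos t)), spine_block (pos t)}"
  then consider t' where "t' < n" "t' \<notin> X" "e = spine_edge t'"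
    | j where "e = {Leg j, Spine (min (j - 1) n)}" unfolding edges_minus by auto
  then show "e = spine_edge t"
  proof cases
    case 1
    then have eq: "{spine_block (pos t'), spine_block (Suc (pos t'))} = {spine_block (Suc (pos t)), spine_block (pos t)}"
      using e block_spine_edge by simp
    have "pos t < pos n" "pos t' < pos n" using assms 1 pos_less by auto
    then have "pos t = pos t'"
      using eq spine_block_eq_iff by (auto simp: doubleton_eq_iff)
    then show ?thesis using assms 1 pos_eq_iff by simp
  next
    case 2
    then have "{Leg j} \<in> {spine_block (Suc (pos t)), spine_block (pos t)}" using e block_leg_edge[of j] by auto
    then show ?thesis by (auto simp: spine_block_def)
  qed
qed

text \<open>
  One slide step for the leaf \<open>Leg j\<close> with label \<open>l\<close>: the candidate edge is the last uncontracted
  one to the left of the leaf.  The minima range over the leaves to its right, and over the leaves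
  \<open>Leg i\<close> (with \<open>i \<ge> 1\<close>, excluding \<open>a\<close>) separated from its left end by contracted edges only.
\<close>

lemma slide_step_contracted:
  assumes inj: "inj_on (\<lambda>j. tree_labels w ! j) {0..n + 2}"
    and L: "dom L = spine_edge ` X"
    and j: "1 \<le> j" "j \<le> n + 2" "tree_labels w ! j = int l"
  shows "(\<And>t. t < min (j - 1) n \<Longrightarrow> t \<in> X) \<Longrightarrow> slide_step ok (tree w) l L = None"
    and "t < min (j - 1) n \<Longrightarrow> t \<notin> X \<Longrightarrow> (\<And>s. t < s \<Longrightarrow> s < min (j - 1) n \<Longrightarrow> s \<in> X) \<Longrightarrow>
      slide_step ok (tree w) l L =
        (if ok (int l)
              (Min ((\<lambda>i. tree_labels w ! i) ` {i. i \<le> n + 2 \<and> i \<noteq> j \<and> t < min (i - 1) n}))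
              (Min ((\<lambda>i. tree_labels w ! i) ` {i. 1 \<le> i \<and> i \<le> n + 2 \<and> min (i - 1) n \<le> t \<and>
                 (\<forall>s. min (i - 1) n \<le> s \<and> s < t \<longrightarrow> s \<in> X)}))
         then Some (L(spine_edge t \<mapsto> l)) else None)"
proof -
  have inj': "inj_on (\<lambda>j. lab T' {Leg j}) {0..n + 2}" using inj by (simp add: contract_lab)
  have lab0: "lab T' {Leg 0} = label_a" by (simp add: contract_lab tree_labels_def)
  have leaf_a: "leaf_of T' label_a = {Leg 0}" using C.leaf_of[OF inj' _ lab0] by simp
  have leaf_l: "leaf_of T' (int l) = {Leg j}" using C.leaf_of[OF inj' j(2)] j(3) contract_lab by simp
  note find = C.find_first_internal_edge[OF j(2), unfolded Let_def]
  have step: "slide_step ok (tree w) l L =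
     (case if pos (min (j - 1) n) = 0 then None
        else Some (spine_block (pos (min (j - 1) n)), spine_block (pos (min (j - 1) n) - 1)) of
       None \<Rightarrow> None
     | Some (u, v) \<Rightarrow>
             if ok (int l) (min_label T' u (int l)) (min_label T' v (int l))
             then Some (L((THE e. e \<in> edges (tree w) - spine_edge ` X \<and> block (tree w) (spine_edge ` X) ` e = {u, v}) \<mapsto> l))
             else None)"
    unfolding slide_step_def L Let_def leaf_a leaf_l using find j(1) by simp
  show "slide_step ok (tree w) l L = None" if "\<And>t. t < min (j - 1) n \<Longrightarrow> t \<in> X"
  proof -
    have "pos (min (j - 1) n) = 0" using pos_eqI[of 0 "min (j - 1) n"] that pos_0 by simp
    then show ?thesis unfolding step by simp
  qed
  assume t: "t < min (j - 1) n" "t \<notin> X" "\<And>s. t < s \<Longrightarrow> s < min (j - 1) n \<Longrightarrow> s \<in> X"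
  have att: "pos (min (j - 1) n) = Suc (pos t)"
    using pos_eqI[of "Suc t" "min (j - 1) n"] t pos_Suc[of t] by simp
  have "i \<le> t \<Longrightarrow> pos i = pos t \<longleftrightarrow> (\<forall>s. i \<le> s \<and> s < t \<longrightarrow> s \<in> X)" for i
    using pos_eqI[of i t] pos_less pos_mono by (metis leD)
  then have same: "pos i = pos t \<longleftrightarrow> i \<le> t \<and> (\<forall>s. i \<le> s \<and> s < t \<longrightarrow> s \<in> X)" for i
    using pos_less[OF t(2), of i] by (metis less_irrefl not_le)
  have lj: "lab T' {Leg j} = int l" using j(3) contract_lab by simp
  have "pos t < pos (min (j - 1) n)" using att by simp
  note ml = C.min_label[OF inj' lab0 j(2) this lj]
  have m1: "min_label T' (spine_block (Suc (pos t))) (int l)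
     = Min ((\<lambda>i. tree_labels w ! i) ` {i. i \<le> n + 2 \<and> i \<noteq> j \<and> t < min (i - 1) n})"
    using ml(2)[OF att] unfolding contract_lab pos_less_iff[OF t(2)] .
  have m2: "min_label T' (spine_block (pos t)) (int l) =
      Min ((\<lambda>i. tree_labels w ! i) ` {i. 1 \<le> i \<and> i \<le> n + 2 \<and> min (i - 1) n \<le> t \<and>
                 (\<forall>s. min (i - 1) n \<le> s \<and> s < t \<longrightarrow> s \<in> X)})"
    using ml(1) unfolding contract_lab same .
  have "t < n" using t by simp
  note the = the_edge[OF this t(2)]
  show "slide_step ok (tree w) l L =
        (if ok (int l)
              (Min ((\<lambda>i. tree_labels w ! i) ` {i. i \<le> n + 2 \<and> i \<noteq> j \<and> t < min (i - 1) n}))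
              (Min ((\<lambda>i. tree_labels w ! i) ` {i. 1 \<le> i \<and> i \<le> n + 2 \<and> min (i - 1) n \<le> t \<and>
                 (\<forall>s. min (i - 1) n \<le> s \<and> s < t \<longrightarrow> s \<in> X)}))
         then Some (L(spine_edge t \<mapsto> l)) else None)"
    unfolding step att by (simp only: the m1 m2 nat.distinct if_False option.case prod.case diff_Suc_1)
qed

end

section \<open>Slide runs and local conditions on words\<close>

text \<open>
  The label of the leaf \<open>Leg (t + 2)\<close> of \<open>tree w\<close>, for \<open>t \<le> length w\<close>: counting from \<open>0\<close>, this is
  the \<open>t\<close>-th leaf after the root.  For \<open>t < length w\<close> it is immediately to the right of the edge
  \<open>w ! t\<close>.
\<close>

definition outer_label :: "nat list \<Rightarrow> nat \<Rightarrow> nat" where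
  "outer_label w t = outer_labels w ({0..length w} - descent_labels w) ! t"

lemma length_outer_labels: "w \<noteq> [] \<Longrightarrow> length (outer_labels w U) = Suc (length w)"
  by (induction w U rule: outer_labels.induct) (auto simp: Let_def)

lemma tree_labels_simps:
  "tree_labels w ! 0 = label_a"
  "tree_labels w ! Suc 0 = label_b"
  "w \<noteq> [] \<Longrightarrow> t \<le> length w \<Longrightarrow> tree_labels w ! Suc (Suc t) = int (outer_label w t)"
  by (simp_all add: tree_labels_def outer_label_def length_outer_labels)

lemma all_tree_labels_iff:
  "(\<forall>j\<le>n + 2. P j) \<longleftrightarrow> P 0 \<and> P 1 \<and> (\<forall>t\<le>n. P (Suc (Suc t)))" for n :: nat
  by (metis Suc_le_mono add_2_eq_Suc' le_numeral_extra(3) not0_implies_Suc One_nat_def le0)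

lemma inj_tree_labels_iff:
  assumes "w \<noteq> []"
  shows "inj_on (\<lambda>j. tree_labels w ! j) {0..length w + 2} \<longleftrightarrow> inj_on (outer_label w) {0..length w}"
proof -
  have "inj_on (\<lambda>j. tree_labels w ! j) {0..length w + 2} \<longleftrightarrow>
    (\<forall>j\<le>length w + 2. \<forall>j'\<le>length w + 2. tree_labels w ! j = tree_labels w ! j' \<longrightarrow> j = j')"
    by (auto simp: inj_on_def)
  also have "\<dots> \<longleftrightarrow> inj_on (outer_label w) {0..length w}"
    unfolding all_tree_labels_iff using assms
    by (auto simp: tree_labels_simps inj_on_def)
  finally show ?thesis .
qed

lemma image_tree_labels_iff:
  assumes "w \<noteq> []"
  shows "(\<lambda>j. tree_labels w ! j) ` {0..length w + 2} = {label_a..int (length w)}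
    \<longleftrightarrow> outer_label w ` {0..length w} = {0..length w}"
proof -
  let ?n = "length w"
  have *: "{0..?n + 2} = {0, 1} \<union> (\<lambda>t. Suc (Suc t)) ` {0..?n}"
  proof -
    have "x \<in> {0, 1} \<union> (\<lambda>t. Suc (Suc t)) ` {0..?n}" if "x \<le> ?n + 2" for x
      using that by (cases x; cases "x - 1") auto
    moreover have "{0, 1} \<union> (\<lambda>t. Suc (Suc t)) ` {0..?n} \<subseteq> {0..?n + 2}" by auto
    ultimately show ?thesis by (intro equalityI subsetI) (metis atLeastAtMost_iff, blast)
  qed
  have 1: "(\<lambda>j. tree_labels w ! j) ` {0..?n + 2} = {label_a, label_b} \<union> int ` outer_label w ` {0..?n}"
    unfolding * image_Un image_image
    using assms by (auto simp: tree_labels_simps image_iff)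
  have 2: "{label_a..int ?n} = {label_a, label_b} \<union> int ` {0..?n}"
  proof -
    have "x \<in> {label_a, label_b} \<union> int ` {0..?n}" if "label_a \<le> x" "x \<le> int ?n" for x
    proof (cases "x \<ge> 0")
      case True
      then have "x = int (nat x)" "nat x \<in> {0..?n}" using that by auto
      then show ?thesis by blast
    qed (use that in auto)
    moreover have "{label_a, label_b} \<union> int ` {0..?n} \<subseteq> {label_a..int ?n}" by auto
    ultimately show ?thesis by (intro equalityI subsetI) (metis atLeastAtMost_iff, blast)
  qed
  have 3: "{label_a, label_b} \<inter> int ` A = {}" for A by auto
  have "int ` outer_label w ` {0..?n} = int ` {0..?n} \<longleftrightarrow> outer_label w ` {0..?n} = {0..?n}"
    by (rule inj_image_eq_iff) simp
  moreover have "C \<union> A = C \<union> B \<longleftrightarrow> A = B" if "C \<inter> A = {}" "C \<inter> B = {}" for A B C :: "int set"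
    using that by blast
  note this[OF 3 3]
  ultimately show ?thesis unfolding 1 2 by simp
qed

lemma tree_degree_ge_3:
  assumes "w \<noteq> []" "i \<le> length w"
  shows "degree (tree w) (Spine i) \<ge> 3"
proof -
  let ?n = "length w"
  have leg: "{Leg j, Spine (min (j - 1) ?n)} \<in> edges (tree w)" if "j \<le> ?n + 2" for j
    using that unfolding tree_simps by auto
  have sp: "{Spine j, Spine (Suc j)} \<in> edges (tree w)" if "j < ?n" for j
    using that unfolding tree_simps by auto
  have "\<exists>E. E \<subseteq> {e \<in> edges (tree w). Spine i \<in> e} \<and> card E = 3"
  proof -
    consider "i = 0" | "0 < i" "i < ?n" | "0 < i" "i = ?n" using assms by linarith
    then show ?thesis
    proof cases
      case 1
      then show ?thesis
        using leg[of 0] leg[of 1] sp[of 0] assms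
        by (intro exI[of _ "{{Leg 0, Spine 0}, {Leg 1, Spine 0}, {Spine 0, Spine 1}}"])
          (auto simp: doubleton_eq_iff)
    next
      case 2
      then show ?thesis
        using leg[of "i + 1"] sp[of i] sp[of "i - 1"]
        by (intro exI[of _ "{{Leg (i + 1), Spine i}, {Spine i, Spine (Suc i)}, {Spine (i - 1), Spine i}}"])
          (auto simp: doubleton_eq_iff)
    next
      case 3
      then show ?thesis
        using leg[of "i + 1"] leg[of "i + 2"] sp[of "i - 1"]
        by (intro exI[of _ "{{Leg (i + 1), Spine i}, {Leg (i + 2), Spine i}, {Spine (i - 1), Spine i}}"])
          (auto simp: doubleton_eq_iff)
    qed
  qed
  moreover have "finite {e \<in> edges (tree w). Spine i \<in> e}" unfolding tree_simps by auto
  ultimately show ?thesis unfolding degree_def by (metis card_mono)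
qed

lemma stable_tree_iff:
  assumes "w \<noteq> []"
  shows "stable_tree (length w) (tree w) \<longleftrightarrow> bij_betw (outer_label w) {0..length w} {0..length w}"
proof -
  interpret caterpillar "tree w" Spine Leg "\<lambda>j. min (j - 1) (length w)" "length w" "length w + 2"
    by (rule tree_caterpillar)
  have "\<forall>v\<in>verts (tree w) - leaves (tree w). 3 \<le> degree (tree w) v"
    unfolding verts leaves using tree_degree_ge_3[OF assms] by auto
  then have "stable_tree (length w) (tree w) \<longleftrightarrow>
    bij_betw (lab (tree w)) (Leg ` {0..length w + 2}) {label_a..int (length w)}"
    unfolding stable_tree_def leaves using is_tree by simp
  also have "\<dots> \<longleftrightarrow> bij_betw (\<lambda>j. tree_labels w ! j) {0..length w + 2} {label_a..int (length w)}"
  proof -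
    have "bij_betw Leg {0..length w + 2} (Leg ` {0..length w + 2})"
      by (simp add: bij_betw_def inj_on_def)
    then have "bij_betw (lab (tree w)) (Leg ` {0..length w + 2}) A \<longleftrightarrow>
      bij_betw (lab (tree w) \<circ> Leg) {0..length w + 2} A" for A
      by (rule bij_betw_comp_iff)
    then show ?thesis by (simp add: comp_def tree_simps)
  qed
  also have "\<dots> \<longleftrightarrow> bij_betw (outer_label w) {0..length w} {0..length w}"
    unfolding bij_betw_def using inj_tree_labels_iff[OF assms] image_tree_labels_iff[OF assms] by simp
  finally show ?thesis .
qed

text \<open>
  The condition on \<open>l\<close>, \<open>m\<^sub>l\<close> and \<open>m\<^sub>a\<close> in a slide; the flag \<open>om\<close> distinguishes \<open>\<omega>\<close> (true) from
  \<open>\<psi>\<close> (false).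
\<close>

definition slide_cond :: "bool \<Rightarrow> int \<Rightarrow> int \<Rightarrow> int \<Rightarrow> bool" where
  "slide_cond om l ml ma \<longleftrightarrow> (om \<longrightarrow> l \<ge> ml) \<and> ml \<ge> ma"

text \<open>
  The leaf labelled \<open>w ! p\<close> lies to the right of the edge \<open>p\<close>, and no edge in between carries a
  smaller letter.
\<close>

definition leaf_between :: "nat list \<Rightarrow> nat \<Rightarrow> bool" where
  "leaf_between w p \<longleftrightarrow> (\<exists>t. p \<le> t \<and> t \<le> length w \<and> outer_label w t = w ! p \<and>
     (\<forall>s. p < s \<and> s \<le> t \<and> s < length w \<longrightarrow> w ! p \<le> w ! s))"

text \<open>
  Let \<open>q\<close> be the last position before \<open>p\<close> with a letter at most \<open>w ! p\<close>.  Some leaf between the edges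
  \<open>q\<close> and \<open>p\<close> has a label at most all labels to the right of \<open>p\<close> other than \<open>w ! p\<close>.  If there is no
  such \<open>q\<close>, the block to the left of \<open>p\<close> contains the leaf \<open>b\<close>, and nothing is required.
\<close>

definition min_on_left :: "nat list \<Rightarrow> nat \<Rightarrow> bool" where
  "min_on_left w p \<longleftrightarrow> (\<forall>q<p. w ! q \<le> w ! p \<and> (\<forall>s. q < s \<and> s < p \<longrightarrow> w ! p < w ! s) \<longrightarrow>
     (\<exists>a. q \<le> a \<and> a < p \<and>
       (\<forall>b. p \<le> b \<and> b \<le> length w \<and> outer_label w b \<noteq> w ! p \<longrightarrow> outer_label w a \<le> outer_label w b)))"

text \<open>
  Some leaf to the right of the edge \<open>p\<close> has a label smaller than \<open>w ! p\<close>: the additional condition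
  for \<open>\<omega>\<close>.
\<close>

definition smaller_on_right :: "nat list \<Rightarrow> nat \<Rightarrow> bool" where
  "smaller_on_right w p \<longleftrightarrow> (\<exists>b. p \<le> b \<and> b \<le> length w \<and> outer_label w b < w ! p)"

text \<open>
  The edge \<open>p\<close> is labelled by a slide of \<open>w ! p\<close> once all edges with larger letters, and those to the
  right of \<open>p\<close> with the same letter, have been labelled.
\<close>

definition slides :: "bool \<Rightarrow> nat list \<Rightarrow> nat \<Rightarrow> bool" where
  "slides om w p \<longleftrightarrow> leaf_between w p \<and> min_on_left w p \<and> (om \<longrightarrow> smaller_on_right w p)"

text \<open>
  The comparison of labels in a slide of the leaf \<open>l\<close> along the edge \<open>t\<close>, when the edges in \<open>X\<close> have
  been contracted.
\<close>

definition edge_cond :: "bool \<Rightarrow> nat list \<Rightarrow> nat set \<Rightarrow> nat \<Rightarrow> nat \<Rightarrow> bool" where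
  "edge_cond om w X l t \<longleftrightarrow>
     (\<forall>q<t. q \<notin> X \<and> (\<forall>s. q < s \<and> s < t \<longrightarrow> s \<in> X) \<longrightarrow>
       (\<exists>a. q \<le> a \<and> a < t \<and>
         (\<forall>b. t \<le> b \<and> b \<le> length w \<and> outer_label w b \<noteq> l \<longrightarrow> outer_label w a \<le> outer_label w b))) \<and>
     (om \<longrightarrow> (\<exists>b. t \<le> b \<and> b \<le> length w \<and> outer_label w b < l))"

lemma ex_last_not_in:
  fixes t :: nat
  assumes "q0 < t" "q0 \<notin> X"
  shows "\<exists>q<t. q \<notin> X \<and> (\<forall>s. q < s \<and> s < t \<longrightarrow> s \<in> X)"
proof -
  have fin: "finite {q. q < t \<and> q \<notin> X}" and ne: "{q. q < t \<and> q \<notin> X} \<noteq> {}" using assms by auto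
  show ?thesis
    using Max_in[OF fin ne] Max_ge[OF fin] by (intro exI[of _ "Max {q. q < t \<and> q \<notin> X}"]) fastforce
qed

lemma Min_le_Min_iff:
  assumes "finite A" "A \<noteq> {}" "finite B" "B \<noteq> {}"
  shows "Min A \<le> Min B \<longleftrightarrow> (\<exists>x\<in>A. \<forall>y\<in>B. x \<le> y)"
  using Min_le_iff[OF assms(1,2), of "Min B"] Min_ge_iff[OF assms(3,4)] by auto

text \<open>
  A word whose tree has the labels \<open>0, \<dots>, length w\<close>, each once, on the leaves after the root.
\<close>

locale labelled_word =
  fixes w :: "nat list"
  assumes ne: "w \<noteq> []"
    and bij: "bij_betw (outer_label w) {0..length w} {0..length w}"
    and set_w: "set w \<subseteq> {1..length w}"
begin

lemma inj: "t \<le> length w \<Longrightarrow> t' \<le> length w \<Longrightarrow> outer_label w t = outer_label w t' \<longleftrightarrow> t = t'"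
  using bij by (auto simp: bij_betw_def inj_on_def)

lemma ex_leaf:
  assumes "l \<le> length w"
  shows "\<exists>t\<le>length w. outer_label w t = l"
proof -
  have "l \<in> outer_label w ` {0..length w}"
    using bij_betw_imp_surj_on[OF bij] assms by simp
  then show ?thesis by auto
qed

lemma slide_cond_Min_iff:
  assumes t0: "t0 \<le> length w" "outer_label w t0 = l" and t: "t < length w"
  shows "slide_cond om (int l)
     (Min ((\<lambda>i. tree_labels w ! i) ` {i. i \<le> length w + 2 \<and> i \<noteq> Suc (Suc t0) \<and> t < min (i - 1) (length w)}))
     (Min ((\<lambda>i. tree_labels w ! i) ` {i. 1 \<le> i \<and> i \<le> length w + 2 \<and> min (i - 1) (length w) \<le> t \<and>
                 (\<forall>s. min (i - 1) (length w) \<le> s \<and> s < t \<longrightarrow> s \<in> X)}))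
    \<longleftrightarrow> edge_cond om w X l t"
proof -
  let ?n = "length w"
  let ?R = "(\<lambda>i. tree_labels w ! i) ` {i. i \<le> ?n + 2 \<and> i \<noteq> Suc (Suc t0) \<and> t < min (i - 1) ?n}"
  let ?I = "{i. 1 \<le> i \<and> i \<le> ?n + 2 \<and> min (i - 1) ?n \<le> t \<and>
                 (\<forall>s. min (i - 1) ?n \<le> s \<and> s < t \<longrightarrow> s \<in> X)}"
  let ?A = "(\<lambda>i. tree_labels w ! i) ` ?I"
  let ?B = "{b. t \<le> b \<and> b \<le> ?n \<and> outer_label w b \<noteq> l}"
  have R: "?R = int ` outer_label w ` ?B"
  proof -
    have "{i. i \<le> ?n + 2 \<and> i \<noteq> Suc (Suc t0) \<and> t < min (i - 1) ?n} = (\<lambda>b. Suc (Suc b)) ` ?B"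
    proof (intro set_eqI iffI)
      fix i assume i: "i \<in> {i. i \<le> ?n + 2 \<and> i \<noteq> Suc (Suc t0) \<and> t < min (i - 1) ?n}"
      then have "i = Suc (Suc (i - 2))" by auto
      moreover from this have "i - 2 \<in> ?B" using inj[of "i - 2" t0] t0 i by auto
      ultimately show "i \<in> (\<lambda>b. Suc (Suc b)) ` ?B" by (rule image_eqI)
    next
      fix i assume "i \<in> (\<lambda>b. Suc (Suc b)) ` ?B"
      then show "i \<in> {i. i \<le> ?n + 2 \<and> i \<noteq> Suc (Suc t0) \<and> t < min (i - 1) ?n}"
        using t0 t by auto
    qed
    then have "?R = (\<lambda>b. tree_labels w ! Suc (Suc b)) ` ?B" by (simp add: image_image)
    also have "\<dots> = (\<lambda>b. int (outer_label w b)) ` ?B"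
      using ne by (intro image_cong) (auto simp: tree_labels_simps)
    finally show ?thesis by (simp add: image_image)
  qed
  have fin: "finite ?R" "finite ?A" by auto
  have "\<exists>b. b \<in> ?B"
  proof (cases "t0 = ?n")
    case True
    then show ?thesis using inj[of "?n - 1" t0] t t0 ne by (intro exI[of _ "?n - 1"]) (auto simp: Suc_le_eq)
  next
    case False
    then show ?thesis using inj[of ?n t0] t t0 by (intro exI[of _ ?n]) auto
  qed
  then have neR: "?R \<noteq> {}" unfolding R by blast
  have neA: "?A \<noteq> {}"
  proof (cases t)
    case 0
    then have "1 \<in> ?I" using t by auto
    then show ?thesis by blast
  next
    case (Suc u)
    then have "Suc t \<in> ?I" using t by auto
    then show ?thesis by blast
  qed
  have "Min ?A \<le> Min ?R \<longleftrightarrow> (\<exists>i\<in>?I. \<forall>b\<in>?B. tree_labels w ! i \<le> int (outer_label w b))"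
    unfolding Min_le_Min_iff[OF fin(2) neA fin(1) neR] unfolding R by simp
  also have "\<dots> \<longleftrightarrow> (\<forall>q<t. q \<notin> X \<and> (\<forall>s. q < s \<and> s < t \<longrightarrow> s \<in> X) \<longrightarrow>
       (\<exists>a. q \<le> a \<and> a < t \<and> (\<forall>b\<in>?B. outer_label w a \<le> outer_label w b)))" (is "_ \<longleftrightarrow> ?Q")
  proof (cases "\<exists>q<t. q \<notin> X")
    case False
    then have "1 \<in> ?I" "?Q" by auto
    moreover have "\<forall>b\<in>?B. tree_labels w ! 1 \<le> int (outer_label w b)" by (simp add: tree_labels_simps)
    ultimately show ?thesis by blast
  next
    case True
    then obtain q0 where "q0 < t" "q0 \<notin> X" by blast
    from ex_last_not_in[OF this]
    obtain q where q: "q < t" "q \<notin> X" "\<And>s. q < s \<Longrightarrow> s < t \<Longrightarrow> s \<in> X"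
      by auto
    have uniq: "q' = q" if "q' < t" "q' \<notin> X" "\<forall>s. q' < s \<and> s < t \<longrightarrow> s \<in> X" for q'
      using that q linorder_less_linear[of q' q] by auto
    have I: "?I = (\<lambda>a. Suc (Suc a)) ` {a. q \<le> a \<and> a < t}"
    proof (intro set_eqI iffI)
      fix i assume i: "i \<in> ?I"
      then have "\<not> min (i - 1) ?n \<le> q" using q(1,2) by auto
      then have "i = Suc (Suc (i - 2))" "i - 2 \<in> {a. q \<le> a \<and> a < t}" using i t by auto
      then show "i \<in> (\<lambda>a. Suc (Suc a)) ` {a. q \<le> a \<and> a < t}" by (rule image_eqI)
    next
      fix i assume "i \<in> (\<lambda>a. Suc (Suc a)) ` {a. q \<le> a \<and> a < t}"
      then show "i \<in> ?I" using q t by auto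
    qed
    have "tree_labels w ! Suc (Suc a) = int (outer_label w a)" if "a < t" for a
      using that t ne by (simp add: tree_labels_simps)
    then have "(\<exists>i\<in>?I. \<forall>b\<in>?B. tree_labels w ! i \<le> int (outer_label w b)) \<longleftrightarrow>
      (\<exists>a. q \<le> a \<and> a < t \<and> (\<forall>b\<in>?B. outer_label w a \<le> outer_label w b))"
      unfolding I by auto
    also have "\<dots> \<longleftrightarrow> ?Q" using q uniq by blast
    finally show ?thesis .
  qed
  finally have 1: "Min ?A \<le> Min ?R \<longleftrightarrow> ?Q" .
  have "Min ?R \<le> int l \<longleftrightarrow> (\<exists>b\<in>?B. outer_label w b \<le> l)"
    using Min_le_iff[OF fin(1) neR, of "int l"] unfolding R by auto
  also have "\<dots> \<longleftrightarrow> (\<exists>b. t \<le> b \<and> b \<le> ?n \<and> outer_label w b < l)"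
    by (auto simp: order_le_less)
  finally have 2: "Min ?R \<le> int l \<longleftrightarrow> (\<exists>b. t \<le> b \<and> b \<le> ?n \<and> outer_label w b < l)" .
  show ?thesis unfolding slide_cond_def edge_cond_def 1 2 by auto
qed

lemma slide_step_iff:
  assumes X: "X \<subseteq> {0..<length w}" and L: "dom L = spine_edge ` X"
    and t0: "t0 \<le> length w" "outer_label w t0 = l"
  shows "slide_step (slide_cond om) (tree w) l L = Some L' \<longleftrightarrow>
    (\<exists>t<length w. t \<notin> X \<and> t \<le> t0 \<and> (\<forall>s. t < s \<and> s \<le> t0 \<and> s < length w \<longrightarrow> s \<in> X) \<and>
       edge_cond om w X l t \<and> L' = L(spine_edge t \<mapsto> l))"
proof -
  interpret contracted_caterpillar w X "length w" by unfold_locales (use X in auto)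
  let ?n = "length w"
  have inj_labels: "inj_on (\<lambda>j. tree_labels w ! j) {0..?n + 2}"
    using inj_tree_labels_iff[OF ne] bij by (simp add: bij_betw_def)
  have j: "1 \<le> Suc (Suc t0)" "Suc (Suc t0) \<le> ?n + 2" "tree_labels w ! Suc (Suc t0) = int l"
    using t0 ne by (auto simp: tree_labels_simps)
  have att: "s < min (Suc (Suc t0) - 1) ?n \<longleftrightarrow> s \<le> t0 \<and> s < ?n" for s using t0 by auto
  note step = slide_step_contracted[OF inj_labels L j, unfolded att]
  show ?thesis
  proof (cases "\<exists>q<Suc (min t0 (?n - 1)). q \<notin> X")
    case False
    then have "t \<in> X" if "t \<le> t0" "t < ?n" for t using that by auto
    then show ?thesis using step(1) by auto
  next
    case True
    then obtain q0 where "q0 < Suc (min t0 (?n - 1))" "q0 \<notin> X" by blast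
    from ex_last_not_in[OF this]
    obtain t where "t < Suc (min t0 (?n - 1))" and t: "t \<notin> X"
        "\<forall>s. t < s \<and> s < Suc (min t0 (?n - 1)) \<longrightarrow> s \<in> X"
      by auto
    then have t': "t \<le> t0" "t < ?n" using ne by (cases w; simp)+
    have gap: "\<And>s. t < s \<Longrightarrow> s \<le> t0 \<and> s < ?n \<Longrightarrow> s \<in> X" using t(2) by auto
    have "slide_step (slide_cond om) (tree w) l L =
        (if edge_cond om w X l t then Some (L(spine_edge t \<mapsto> l)) else None)"
      using step(2)[of t "slide_cond om"] t' t(1) gap
      unfolding slide_cond_Min_iff[OF t0 t'(2)] by blast
    moreover have uniq: "s = t" if "s < ?n" "s \<notin> X" "s \<le> t0" "\<forall>s'. s < s' \<and> s' \<le> t0 \<and> s' < ?n \<longrightarrow> s' \<in> X" for s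
      using that t' t(1) gap linorder_less_linear[of s t] by auto
    moreover have "(\<exists>s<?n. s \<notin> X \<and> s \<le> t0 \<and> (\<forall>s'. s < s' \<and> s' \<le> t0 \<and> s' < ?n \<longrightarrow> s' \<in> X) \<and>
       edge_cond om w X l s \<and> L' = L(spine_edge s \<mapsto> l))
       \<longleftrightarrow> edge_cond om w X l t \<and> L' = L(spine_edge t \<mapsto> l)" (is "(\<exists>s<?n. ?P s) \<longleftrightarrow> ?Q")
    proof
      assume "\<exists>s<?n. ?P s"
      then obtain s where s: "s < ?n" "?P s" by blast
      then have "s = t" using uniq by blast
      then show ?Q using s by blast
    next
      assume ?Q
      then have "?P t" using t' t(1) gap by blast
      then show "\<exists>s<?n. ?P s" using t'(2) by blast
    qed
    ultimately show ?thesis by auto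
  qed
qed

text \<open>
  A run never relabels an edge, and a letter \<open>l\<close> is only put on edges to the left of the leaf \<open>l\<close>.
\<close>

lemma slide_run_labels:
  assumes "X \<subseteq> {0..<length w}" "dom L = spine_edge ` X" "set ls \<subseteq> {0..length w}"
    and "slide_run (slide_cond om) (tree w) ls L = Some L'"
  shows "(\<forall>s\<in>X. L' (spine_edge s) = L (spine_edge s)) \<and>
    (\<forall>s<length w. \<forall>l. s \<notin> X \<longrightarrow> L' (spine_edge s) = Some l \<longrightarrow> (\<exists>t0\<le>length w. outer_label w t0 = l \<and> s \<le> t0))"
  using assms
proof (induction ls arbitrary: X L)
  case Nil
  have "spine_edge s \<notin> dom L" if "s \<notin> X" for s
    using that Nil(2) by (auto simp: spine_edge_eq_iff)
  then have "L (spine_edge s) = None" if "s \<notin> X" for s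
    using that by (simp add: domIff)
  then show ?case using Nil(4) by auto
next
  case (Cons l ls)
  obtain L1 where L1: "slide_step (slide_cond om) (tree w) l L = Some L1"
      and run: "slide_run (slide_cond om) (tree w) ls L1 = Some L'"
    using Cons.prems(4) by (auto split: option.splits)
  obtain t0 where t0: "t0 \<le> length w" "outer_label w t0 = l" using ex_leaf Cons.prems(3) by auto
  obtain t where t: "t < length w" "t \<notin> X" "t \<le> t0" "L1 = L(spine_edge t \<mapsto> l)"
    using L1 unfolding slide_step_iff[OF Cons.prems(1,2) t0] by blast
  have "insert t X \<subseteq> {0..<length w}" "dom L1 = spine_edge ` insert t X" "set ls \<subseteq> {0..length w}"
    using Cons.prems t by auto
  note IH = Cons.IH[OF this run]
  have old: "L' (spine_edge s) = L (spine_edge s)" if "s \<in> X" for s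
  proof -
    have "L' (spine_edge s) = L1 (spine_edge s)" "s \<noteq> t" using IH that t(2) by auto
    then show ?thesis using t(4) spine_edge_eq_iff[of s t] by simp
  qed
  have new: "\<exists>t0\<le>length w. outer_label w t0 = l' \<and> s \<le> t0"
    if "s < length w" "s \<notin> X" "L' (spine_edge s) = Some l'" for s l'
  proof (cases "s = t")
    case True
    then have "l' = l" using IH t(4) that(3) by simp
    then show ?thesis using t0 t(3) True by blast
  next
    case False
    then show ?thesis using IH that by blast
  qed
  show ?case using old new by blast
qed

text \<open>
  \<open>ps\<close> lists the positions still to be labelled, by decreasing letter and from right to left among
  equal letters; \<open>X\<close> is the set of the positions labelled so far, all of which precede \<open>ps\<close> in this
  order.
\<close>

lemma slide_run_reads_iff:
  assumes "X = {0..<length w} - set ps" "set ps \<subseteq> {0..<length w}"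
    and "sorted_wrt (\<lambda>p q. w ! q < w ! p \<or> w ! q = w ! p \<and> q < p) ps"
    and "\<And>p q. p \<in> X \<Longrightarrow> q \<in> set ps \<Longrightarrow> w ! q < w ! p \<or> w ! q = w ! p \<and> q < p"
    and "dom L = spine_edge ` X" "\<And>s. s \<in> X \<Longrightarrow> L (spine_edge s) = Some (w ! s)"
  shows "(\<exists>L'. slide_run (slide_cond om) (tree w) (map ((!) w) ps) L = Some L' \<and> reads L' w)
    \<longleftrightarrow> (\<forall>p\<in>set ps. slides om w p)"
  using assms
proof (induction ps arbitrary: X L)
  case Nil
  then show ?case by (simp add: reads_def)
next
  case (Cons p ps)
  let ?n = "length w"
  have p: "p < ?n" "p \<notin> X" and X: "X \<subseteq> {0..<?n}" using Cons.prems(1,2) by auto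
  have rest: "w ! q < w ! p \<or> w ! q = w ! p \<and> q < p" if "q \<in> set ps" for q
    using Cons.prems(3) that by simp
  have mem: "s \<in> X \<longleftrightarrow> w ! p < w ! s \<or> w ! p = w ! s \<and> p < s" if "s < ?n" for s
    using Cons.prems(4)[of s p] rest[of s] that Cons.prems(1) by auto
  have letters: "w ! s \<le> ?n" if "s < ?n" for s using set_w that by (auto simp: subset_iff)
  obtain t0 where t0: "t0 \<le> ?n" "outer_label w t0 = w ! p" using ex_leaf letters p(1) by blast
  have slides: "slides om w p \<longleftrightarrow>
     p \<le> t0 \<and> (\<forall>s. p < s \<and> s \<le> t0 \<and> s < ?n \<longrightarrow> s \<in> X) \<and> edge_cond om w X (w ! p) p"
  proof -
    have "leaf_between w p \<longleftrightarrow> p \<le> t0 \<and> (\<forall>s. p < s \<and> s \<le> t0 \<and> s < ?n \<longrightarrow> w ! p \<le> w ! s)"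
      unfolding leaf_between_def using inj t0 by metis
    moreover have "s \<in> X \<longleftrightarrow> w ! p \<le> w ! s" if "p < s" "s < ?n" for s
      using mem[OF that(2)] that(1) by auto
    moreover have "s \<in> X \<longleftrightarrow> w ! p < w ! s" if "s < p" for s
      using mem[of s] that p(1) by auto
    ultimately show ?thesis
      unfolding slides_def min_on_left_def smaller_on_right_def edge_cond_def
      by (smt (verit, ccfv_threshold) linorder_not_less)
  qed
  let ?L1 = "L(spine_edge p \<mapsto> w ! p)"
  have IH: "(\<exists>L'. slide_run (slide_cond om) (tree w) (map ((!) w) ps) ?L1 = Some L' \<and> reads L' w)
    \<longleftrightarrow> (\<forall>p\<in>set ps. slides om w p)"
  proof (rule Cons.IH[of "insert p X"])
    have "p \<notin> set ps" using rest by blast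
    then show "insert p X = {0..<?n} - set ps" using Cons.prems(1) p(1) by auto
    show "w ! q < w ! p' \<or> w ! q = w ! p' \<and> q < p'" if "p' \<in> insert p X" "q \<in> set ps" for p' q
      using that rest Cons.prems(4) by auto
    show "dom ?L1 = spine_edge ` insert p X" using Cons.prems(5) by simp
    show "?L1 (spine_edge s) = Some (w ! s)" if "s \<in> insert p X" for s
      using that Cons.prems(6) by (auto simp: spine_edge_eq_iff)
  qed (use Cons.prems(2,3) in auto)
  show ?case
  proof
    assume "\<exists>L'. slide_run (slide_cond om) (tree w) (map ((!) w) (p # ps)) L = Some L' \<and> reads L' w"
    then obtain L' where L': "slide_run (slide_cond om) (tree w) (map ((!) w) (p # ps)) L = Some L'"
      "reads L' w" by blast
    then obtain L1 where L1: "slide_step (slide_cond om) (tree w) (w ! p) L = Some L1"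
      "slide_run (slide_cond om) (tree w) (map ((!) w) ps) L1 = Some L'"
      by (auto split: option.splits)
    obtain t where t: "t < ?n" "t \<notin> X" "t \<le> t0" "\<forall>s. t < s \<and> s \<le> t0 \<and> s < ?n \<longrightarrow> s \<in> X"
       "edge_cond om w X (w ! p) t" "L1 = L(spine_edge t \<mapsto> w ! p)"
      using L1(1) unfolding slide_step_iff[OF X Cons.prems(5) t0] by blast
    have "set (map ((!) w) (p # ps)) \<subseteq> {0..?n}" "set (map ((!) w) ps) \<subseteq> {0..?n}"
      using Cons.prems(2) letters by auto
    note lab = slide_run_labels[OF X Cons.prems(5) this(1) L'(1)]
      and lab1 = slide_run_labels[OF _ _ this(2) L1(2), of "insert t X"]
    have "L' (spine_edge t) = L1 (spine_edge t)" using lab1 X t(1,6) Cons.prems(5) by auto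
    then have wt: "w ! t = w ! p" using L'(2) t(1,6) by (simp add: reads_def)
    have "\<exists>t0\<le>?n. outer_label w t0 = w ! p \<and> p \<le> t0"
      using lab p L'(2) unfolding reads_def by blast
    then have "p \<le> t0" using inj t0 by metis
    \<comment> \<open>The step labels some edge \<open>t\<close>.  It carries the letter \<open>w ! p\<close>, so \<open>t \<le> p\<close>, as \<open>p\<close> is the
      rightmost unlabelled such edge; and \<open>p\<close> is left of the leaf, so \<open>t < p\<close> would skip \<open>p\<close>.\<close>
    have "t \<le> p" using mem[OF t(1)] wt t(2) by auto
    then have "t = p" using t(4) \<open>p \<le> t0\<close> p by (metis le_neq_implies_less)
    then have "slides om w p" using slides \<open>p \<le> t0\<close> t(4,5) by simp
    moreover have "\<forall>p\<in>set ps. slides om w p" using IH L1(2) L'(2) t(6) \<open>t = p\<close> by blast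
    ultimately show "\<forall>p\<in>set (p # ps). slides om w p" by simp
  next
    assume *: "\<forall>p\<in>set (p # ps). slides om w p"
    then have "slide_step (slide_cond om) (tree w) (w ! p) L = Some ?L1"
      using slides p unfolding slide_step_iff[OF X Cons.prems(5) t0] by auto
    then show "\<exists>L'. slide_run (slide_cond om) (tree w) (map ((!) w) (p # ps)) L = Some L' \<and> reads L' w"
      using IH * by simp
  qed
qed

end

lemma sorted_wrt_concat_map:
  assumes "sorted_wrt Q ls" "\<And>l. l \<in> set ls \<Longrightarrow> sorted_wrt R (f l)"
    and "\<And>l m x y. Q l m \<Longrightarrow> x \<in> set (f l) \<Longrightarrow> y \<in> set (f m) \<Longrightarrow> R x y"
  shows "sorted_wrt R (concat (map f ls))"
  using assms(1,2)
proof (induction ls)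
  case (Cons l ls)
  have "R x y" if "x \<in> set (f l)" "m \<in> set ls" "y \<in> set (f m)" for x y m
    using assms(3)[of l m x y] Cons.prems(1) that by simp
  then show ?case using Cons by (simp add: sorted_wrt_append)
qed simp

lemma length_filter_positions:
  "length (filter (\<lambda>p. w ! p = l) [0..<length w]) = count_list w l"
proof -
  have "count_list w l = length (filter ((=) l) (map ((!) w) [0..<length w]))"
    by (simp add: map_nth count_list_eq_length_filter)
  also have "\<dots> = length (filter (\<lambda>p. w ! p = l) [0..<length w])"
    unfolding filter_map length_map comp_def by (simp only: eq_commute[of l])
  finally show ?thesis ..
qed

lemma slide_labeling_reads_iff:
  assumes "n \<ge> 1" "has_content n k w" "length w = n"
  shows "stable_tree n (tree w) \<and> slide_labeling (slide_cond om) n k (tree w) \<noteq> None \<and>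
       reads (the (slide_labeling (slide_cond om) n k (tree w))) w
    \<longleftrightarrow> bij_betw (outer_label w) {0..n} {0..n} \<and> (\<forall>p<n. slides om w p)"
proof (cases "bij_betw (outer_label w) {0..n} {0..n}")
  case False
  moreover have "w \<noteq> []" using assms by auto
  ultimately show ?thesis using stable_tree_iff[of w] assms by simp
next
  case True
  have set_w: "set w \<subseteq> {1..n}" using assms(2) unfolding has_content_def by simp
  interpret labelled_word w
    using True assms(1,3) set_w by unfold_locales auto
  let ?R = "\<lambda>p q. w ! q < w ! p \<or> w ! q = w ! p \<and> q < p"
  let ?f = "\<lambda>l. rev (filter (\<lambda>p. w ! p = l) [0..<length w])"
  define ps where "ps = concat (map ?f (rev [1..<n + 1]))"
  have "w ! p \<in> {1..n}" if "p < n" for p using set_w that assms(3) nth_mem by blast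
  then have set_ps: "set ps = {0..<n}" unfolding ps_def using assms(3) by fastforce
  have "replicate (k l) l = map ((!) w) (?f l)" if "l \<in> {1..n}" for l
  proof -
    have "map ((!) w) (?f l) = map (\<lambda>_. l) (?f l)" by (intro map_cong) auto
    also have "\<dots> = replicate (count_list w l) l"
      by (simp only: map_replicate_const length_rev length_filter_positions)
    finally show ?thesis using assms(2) that by (simp add: has_content_def)
  qed
  then have "map (\<lambda>l. replicate (k l) l) (rev [1..<n + 1]) = map (\<lambda>l. map ((!) w) (?f l)) (rev [1..<n + 1])"
    by (intro map_cong) auto
  then have ls: "concat (map (\<lambda>l. replicate (k l) l) (rev [1..<n + 1])) = map ((!) w) ps"
    unfolding ps_def map_concat map_map comp_def by (rule arg_cong)
  have sorted: "sorted_wrt ?R ps"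
    unfolding ps_def
  proof (rule sorted_wrt_concat_map)
    show "sorted_wrt (>) (rev [1..<n + 1])" by (simp add: sorted_wrt_rev del: upt_Suc)
    show "sorted_wrt ?R (?f l)" for l
    proof -
      have "sorted_wrt (\<lambda>p q. q < p) (?f l)" by (simp add: sorted_wrt_rev sorted_wrt_filter)
      then show ?thesis by (rule sorted_wrt_mono_rel[rotated]) auto
    qed
  qed auto
  have "(\<exists>L'. slide_run (slide_cond om) (tree w) (map ((!) w) ps) Map.empty = Some L' \<and> reads L' w)
    \<longleftrightarrow> (\<forall>p\<in>set ps. slides om w p)"
    by (rule slide_run_reads_iff[of "{}"]) (use set_ps sorted assms(3) in auto)
  then show ?thesis
    using True stable_tree_iff[OF ne] assms(3) set_ps unfolding slide_labeling_def ls by auto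
qed

section \<open>The greedy labels\<close>

text \<open>
  The leaf \<open>t\<close> lies between two edges and is a nondescent leaf.
\<close>

definition ascent :: "nat list \<Rightarrow> nat \<Rightarrow> bool" where
  "ascent w t \<longleftrightarrow> Suc t < length w \<and> w ! t \<le> w ! Suc t"

text \<open>
  The leaf \<open>t\<close> is a descent leaf; this includes the descent leaf \<open>length w - 1\<close> at the right end.
\<close>

definition descent :: "nat list \<Rightarrow> nat \<Rightarrow> bool" where
  "descent w t \<longleftrightarrow> t < length w \<and> (Suc t < length w \<longrightarrow> w ! Suc t < w ! t)"

text \<open>
  The labels that remain when \<open>outer_labels w U\<close> comes to the leaf \<open>t\<close>.
\<close>

definition unused_from :: "nat list \<Rightarrow> nat set \<Rightarrow> nat \<Rightarrow> nat set" where
  "unused_from w U t = U - {outer_labels w U ! s | s. s < t \<and> ascent w s}"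

lemma unused_from_0: "unused_from w U 0 = U"
  by (simp add: unused_from_def)

lemma ascent_Cons: "ascent (x # w) (Suc s) = ascent w s"
  by (simp add: ascent_def)

lemma Collect_less_Suc_split:
  "{f s' |s'. s' < Suc s \<and> Q s'} = (if Q 0 then {f 0} else {}) \<union> {f (Suc s') |s'. s' < s \<and> Q (Suc s')}"
  (is "?L = ?R")
proof (intro equalityI subsetI)
  fix x assume "x \<in> ?L"
  then obtain s' where "x = f s'" "s' < Suc s" "Q s'" by blast
  then show "x \<in> ?R" by (cases s') auto
next
  fix x assume "x \<in> ?R"
  then consider "Q 0" "x = f 0" | s' where "x = f (Suc s')" "s' < s" "Q (Suc s')"
    by (auto split: if_splits)
  then show "x \<in> ?L" by cases (blast, metis (mono_tags, lifting) Suc_mono mem_Collect_eq)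
qed

lemma unused_from_Cons:
  "x > y \<Longrightarrow> unused_from (x # y # w) U (Suc s) = unused_from (y # w) U s"
  "x \<le> y \<Longrightarrow> m = (if Min U = y then Min (U - {y}) else Min U) \<Longrightarrow>
     unused_from (x # y # w) U (Suc s) = unused_from (y # w) (U - {m}) s"
proof -
  assume "x > y"
  then have ol: "outer_labels (x # y # w) U = x # outer_labels (y # w) U" by simp
  have "\<not> ascent (x # y # w) 0" using \<open>x > y\<close> by (simp add: ascent_def)
  then have "{outer_labels (x # y # w) U ! s' |s'. s' < Suc s \<and> ascent (x # y # w) s'} =
     {outer_labels (y # w) U ! s' |s'. s' < s \<and> ascent (y # w) s'}"
    unfolding ol Collect_less_Suc_split by (simp add: ascent_Cons)
  then show "unused_from (x # y # w) U (Suc s) = unused_from (y # w) U s"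
    unfolding unused_from_def by simp
next
  assume *: "x \<le> y" "m = (if Min U = y then Min (U - {y}) else Min U)"
  then have ol: "outer_labels (x # y # w) U = m # outer_labels (y # w) (U - {m})"
    by (simp add: Let_def)
  have "ascent (x # y # w) 0" using * by (simp add: ascent_def)
  then have "{outer_labels (x # y # w) U ! s' |s'. s' < Suc s \<and> ascent (x # y # w) s'} =
     insert m {outer_labels (y # w) (U - {m}) ! s' |s'. s' < s \<and> ascent (y # w) s'}"
    unfolding ol Collect_less_Suc_split by (simp add: ascent_Cons)
  then show "unused_from (x # y # w) U (Suc s) = unused_from (y # w) (U - {m}) s"
    unfolding unused_from_def by auto
qed

text \<open>
  The recursion for the labels, as a description of each single label.
\<close>

lemma outer_labels_nth:
  assumes "w \<noteq> []"
  shows "descent w t \<Longrightarrow> outer_labels w U ! t = w ! t"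
    and "ascent w t \<Longrightarrow> outer_labels w U ! t =
      (if Min (unused_from w U t) = w ! Suc t then Min (unused_from w U t - {w ! Suc t})
       else Min (unused_from w U t))"
    and "outer_labels w U ! length w = Min (unused_from w U (length w))"
proof -
  have "(descent w t \<longrightarrow> outer_labels w U ! t = w ! t) \<and>
    (ascent w t \<longrightarrow> outer_labels w U ! t =
      (if Min (unused_from w U t) = w ! Suc t then Min (unused_from w U t - {w ! Suc t})
       else Min (unused_from w U t))) \<and>
    outer_labels w U ! length w = Min (unused_from w U (length w))"
    using assms
  proof (induction w U arbitrary: t rule: outer_labels.induct)
    case (2 x U)
    then show ?case by (auto simp: descent_def ascent_def unused_from_def)
  next
    case (3 x y w U)
    define m where "m = (if Min U = y then Min (U - {y}) else Min U)"
    show ?case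
    proof (cases "x > y")
      case True
      note IH = "3.IH"(1)[OF True]
      have ol: "outer_labels (x # y # w) U = x # outer_labels (y # w) U" using True by simp
      show ?thesis
      proof (cases t)
        case 0
        then show ?thesis using True IH unfolding ol
          by (auto simp: ascent_def unused_from_Cons)
      next
        case (Suc s)
        then show ?thesis using True IH[of s] unfolding ol
          by (auto simp: ascent_Cons unused_from_Cons descent_def)
      qed
    next
      case False
      note IH = "3.IH"(2)[OF False m_def]
      have ol: "outer_labels (x # y # w) U = m # outer_labels (y # w) (U - {m})"
        using False by (simp add: m_def Let_def)
      have un: "unused_from (x # y # w) U (Suc s) = unused_from (y # w) (U - {m}) s" for s
        using unused_from_Cons(2)[OF _ m_def] False by simp
      show ?thesis
      proof (cases t)
        case 0
        then show ?thesis using False IH unfolding ol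
          by (auto simp: descent_def un unused_from_0 m_def)
      next
        case (Suc s)
        then show ?thesis using False IH[of s] unfolding ol
          by (auto simp: ascent_Cons un descent_def)
      qed
    qed
  qed simp
  then show "descent w t \<Longrightarrow> outer_labels w U ! t = w ! t"
    and "ascent w t \<Longrightarrow> outer_labels w U ! t =
      (if Min (unused_from w U t) = w ! Suc t then Min (unused_from w U t - {w ! Suc t})
       else Min (unused_from w U t))"
    and "outer_labels w U ! length w = Min (unused_from w U (length w))"
    by blast+
qed

text \<open>
  The labels available for nondescent leaves from the leaf \<open>t\<close> on.
\<close>

definition unused :: "nat list \<Rightarrow> nat \<Rightarrow> nat set" where
  "unused w t = {0..length w} - descent_labels w - {outer_label w s | s. s < t \<and> ascent w s}"

lemma unused_eq: "unused w t = unused_from w ({0..length w} - descent_labels w) t"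
  unfolding unused_def unused_from_def outer_label_def ..

lemma descent_labels_eq: "descent_labels w = (!) w ` {t. descent w t}"
  unfolding descent_labels_def descent_def by (auto simp: image_iff)

lemma not_descent_iff: "t < length w \<Longrightarrow> \<not> descent w t \<longleftrightarrow> ascent w t"
  unfolding descent_def ascent_def by auto

locale letter_word =
  fixes w :: "nat list"
  assumes w_ne: "w \<noteq> []" and w_letters: "set w \<subseteq> {1..length w}"
begin

lemma letter_le: "t < length w \<Longrightarrow> w ! t \<le> length w" "t < length w \<Longrightarrow> 0 < w ! t"
proof -
  assume "t < length w"
  then have "w ! t \<in> {1..length w}" using w_letters nth_mem by blast
  then show "w ! t \<le> length w" "0 < w ! t" by auto
qed

text \<open>
  There are always enough labels: one for each remaining nondescent leaf between two edges, and one
  more for the rightmost leaf.  Hence every minimum in the definition of the labels is taken over a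
  nonempty set.
\<close>

lemma card_unused: "card {s. ascent w s} - card {s. s < t \<and> ascent w s} + 1 \<le> card (unused w t)"
proof -
  let ?n = "length w"
  have fin: "finite {s. ascent w s}" "finite {s. descent w s}"
    by (rule finite_subset[of _ "{..<?n}"]; auto simp: ascent_def descent_def)+
  have "{..<?n} = {s. descent w s} \<union> {s. ascent w s}" "{s. descent w s} \<inter> {s. ascent w s} = {}"
    by (auto simp: ascent_def descent_def)
  then have n: "?n = card {s. descent w s} + card {s. ascent w s}"
    using card_Un_disjoint[OF fin(2,1)] by (metis card_lessThan)
  have "card (descent_labels w) \<le> card {s. descent w s}"
    unfolding descent_labels_eq by (rule card_image_le[OF fin(2)])
  moreover have "card {0..?n} - card (descent_labels w) \<le> card ({0..?n} - descent_labels w)"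
    unfolding descent_labels_eq using fin(2) by (intro diff_card_le_card_Diff) auto
  ultimately have 1: "card {s. ascent w s} + 1 \<le> card ({0..?n} - descent_labels w)" using n by simp
  have img: "{outer_label w s | s. s < t \<and> ascent w s} = outer_label w ` {s. s < t \<and> ascent w s}"
    by auto
  have fin': "finite {s. s < t \<and> ascent w s}" by auto
  have "card ({0..?n} - descent_labels w) - card (outer_label w ` {s. s < t \<and> ascent w s}) \<le> card (unused w t)"
    unfolding unused_def img using fin' by (intro diff_card_le_card_Diff) auto
  moreover have "card (outer_label w ` {s. s < t \<and> ascent w s}) \<le> card {s. s < t \<and> ascent w s}"
    by (rule card_image_le[OF fin'])
  moreover have "card {s. s < t \<and> ascent w s} \<le> card {s. ascent w s}"
    by (rule card_mono[OF fin(1)]) auto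
  ultimately show ?thesis using 1 by linarith
qed

lemma finite_unused: "finite (unused w t)"
  by (simp add: unused_def)

lemma outer_label_descent: "descent w t \<Longrightarrow> outer_label w t = w ! t"
  unfolding outer_label_def using outer_labels_nth(1)[OF w_ne] .

lemma outer_label_ascent:
  assumes "ascent w t"
  shows "outer_label w t \<in> unused w t" "outer_label w t \<noteq> w ! Suc t"
    "\<And>u. u \<in> unused w t \<Longrightarrow> u \<noteq> w ! Suc t \<Longrightarrow> outer_label w t \<le> u"
proof -
  let ?V = "unused w t" and ?y = "w ! Suc t"
  have eq: "outer_label w t = (if Min ?V = ?y then Min (?V - {?y}) else Min ?V)"
    unfolding outer_label_def unused_eq using outer_labels_nth(2)[OF w_ne assms] .
  have "card {s. s < t \<and> ascent w s} < card {s. ascent w s}"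
  proof (rule psubset_card_mono)
    show "finite {s. ascent w s}" by (rule finite_subset[of _ "{..<length w}"]) (auto simp: ascent_def)
    show "{s. s < t \<and> ascent w s} \<subset> {s. ascent w s}" using assms by auto
  qed
  then have card: "2 \<le> card ?V" using card_unused[of t] by linarith
  then have ne: "?V \<noteq> {}" by auto
  have "card ?V - 1 \<le> card (?V - {?y})" by (metis diff_card_le_card_Diff finite.emptyI finite_insert is_singletonI is_singleton_altdef)
  then have "0 < card (?V - {?y})" using card by linarith
  then have ne': "?V - {?y} \<noteq> {}" by (metis card.empty less_irrefl)
  have in1: "Min ?V \<in> ?V" and in2: "Min (?V - {?y}) \<in> ?V - {?y}"
    using Min_in[OF _ ne] Min_in[OF _ ne'] finite_unused by auto
  show "outer_label w t \<in> ?V" "outer_label w t \<noteq> ?y" using eq in1 in2 by auto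
  show "outer_label w t \<le> u" if "u \<in> ?V" "u \<noteq> ?y" for u
    unfolding eq using that finite_unused by auto
qed

lemma outer_label_last: "outer_label w (length w) \<in> unused w (length w)"
proof -
  have "outer_label w (length w) = Min (unused w (length w))"
    unfolding outer_label_def unused_eq using outer_labels_nth(3)[OF w_ne] .
  moreover have "unused w (length w) \<noteq> {}"
    using card_unused[of "length w"] by auto
  ultimately show ?thesis using Min_in[OF finite_unused] by simp
qed

lemma unused_mono: "t \<le> t' \<Longrightarrow> unused w t' \<subseteq> unused w t"
  unfolding unused_def by auto

lemma outer_label_not_descent:
  "t \<le> length w \<Longrightarrow> \<not> descent w t \<Longrightarrow> outer_label w t \<in> unused w t"
  using outer_label_ascent(1) outer_label_last not_descent_iff by (cases "t = length w") auto

text \<open>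
  In a word avoiding \<open>2-1-2\<close>, a letter that is followed by a smaller one does not occur again, so
  no label is used for two descent leaves.
\<close>

lemma descent_last:
  assumes "avoids_2_1_2 w" "descent w t" "t < s" "s < length w"
  shows "w ! s \<noteq> w ! t"
proof
  assume eq: "w ! s = w ! t"
  have "w ! Suc t < w ! t" using assms by (auto simp: descent_def)
  moreover from this have "Suc t < s" using eq assms(3) by (metis Suc_lessI less_irrefl)
  ultimately show False using assms(1,4) eq unfolding avoids_2_1_2_def by (metis lessI)
qed

lemma bij_outer_label:
  assumes "avoids_2_1_2 w"
  shows "bij_betw (outer_label w) {0..length w} {0..length w}"
proof -
  let ?n = "length w"
  have "outer_label w t \<noteq> outer_label w t'" if "t < t'" "t' \<le> ?n" for t t'
  proof -
    have t: "t < ?n" using that by simp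
    consider "descent w t" "descent w t'" | "descent w t" "\<not> descent w t'"
      | "\<not> descent w t" "descent w t'" | "\<not> descent w t" "\<not> descent w t'" by blast
    then show ?thesis
    proof cases
      case 1
      then show ?thesis using descent_last[OF assms 1(1) that(1)] that
        by (auto simp: outer_label_descent descent_def)
    next
      case 2
      then have "outer_label w t' \<notin> descent_labels w"
        using outer_label_not_descent[of t'] that by (auto simp: unused_def)
      moreover have "outer_label w t \<in> descent_labels w"
        using 2 by (auto simp: descent_labels_eq outer_label_descent)
      ultimately show ?thesis by metis
    next
      case 3
      then have "outer_label w t \<notin> descent_labels w"
        using outer_label_not_descent[of t] that by (auto simp: unused_def)
      moreover have "outer_label w t' \<in> descent_labels w"
        using 3 by (auto simp: descent_labels_eq outer_label_descent)
      ultimately show ?thesis by metis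
    next
      case 4
      then have "outer_label w t' \<in> unused w t'" "ascent w t"
        using outer_label_not_descent[of t'] not_descent_iff t that by auto
      then show ?thesis using that(1) unfolding unused_def by auto
    qed
  qed
  then have inj: "inj_on (outer_label w) {0..?n}"
    by (intro linorder_inj_onI) auto
  have "outer_label w t \<in> {0..?n}" if "t \<le> ?n" for t
  proof (cases "descent w t")
    case True
    then show ?thesis using letter_le by (simp add: outer_label_descent descent_def)
  next
    case False
    then show ?thesis using outer_label_not_descent[OF that] by (auto simp: unused_def)
  qed
  then have "outer_label w ` {0..?n} \<subseteq> {0..?n}" by (intro image_subsetI) simp
  then have "outer_label w ` {0..?n} = {0..?n}" using inj by (intro endo_inj_surj) auto
  then show ?thesis using inj by (simp add: bij_betw_def)
qed

end

text \<open>
  Both repetition numbers count, over a set \<open>A\<close> of letters, the occurrences in a suffix \<open>v\<close> minus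
  the distinct letters in it.
\<close>

lemma sum_count_list_pred:
  assumes "finite A"
  shows "(\<Sum>j\<in>A. count_list v j - 1) + card (A \<inter> set v) = length (filter (\<lambda>x. x \<in> A) v)"
proof -
  have "(\<Sum>j\<in>A. count_list v j) = length (filter (\<lambda>x. x \<in> A) v)"
  proof (induction v)
    case (Cons x v)
    have "(\<Sum>j\<in>A. count_list (x # v) j) = (\<Sum>j\<in>A. count_list v j + (if j = x then 1 else 0))"
      by (intro sum.cong) auto
    also have "\<dots> = (\<Sum>j\<in>A. count_list v j) + (if x \<in> A then 1 else 0)"
      using assms by (simp add: sum.distrib sum.delta')
    finally show ?case using Cons by simp
  qed simp
  moreover have "(\<Sum>j\<in>A. count_list v j) = (\<Sum>j\<in>A. (count_list v j - 1) + (if j \<in> set v then 1 else 0))"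
    by (intro sum.cong) (auto simp: count_list_0_iff Suc_le_eq[symmetric] count_notin intro!: Suc_leI, metis Suc_pred count_list_0_iff neq0_conv)
  moreover have "(\<Sum>j\<in>A. if j \<in> set v then 1 else 0) = card (A \<inter> set v)"
    using assms by (simp add: sum.If_cases)
  ultimately show ?thesis by (simp add: sum.distrib)
qed

text \<open>
  The rightmost maximal group of \<open>i\<close>'s in \<open>w\<close> occupies the positions \<open>g, \<dots>, p\<close>.
\<close>

definition last_run :: "nat list \<Rightarrow> nat \<Rightarrow> nat \<Rightarrow> nat \<Rightarrow> bool" where
  "last_run w i g p \<longleftrightarrow> g \<le> p \<and> p < length w \<and> (\<forall>s. g \<le> s \<and> s \<le> p \<longrightarrow> w ! s = i) \<and>
     (\<forall>s. p < s \<and> s < length w \<longrightarrow> w ! s \<noteq> i) \<and> (g = 0 \<or> w ! (g - 1) \<noteq> i)"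

lemma last_runD:
  assumes "last_run w i g p"
  shows "g \<le> p" "p < length w" "\<And>s. g \<le> s \<Longrightarrow> s \<le> p \<Longrightarrow> w ! s = i"
    "\<And>s. p < s \<Longrightarrow> s < length w \<Longrightarrow> w ! s \<noteq> i" "g = 0 \<or> w ! (g - 1) \<noteq> i"
    "w ! p = i" "w ! g = i"
  using assms unfolding last_run_def by auto

lemma ex_last_run:
  assumes "i \<in> set w" "set w \<subseteq> {1..length w}"
  shows "\<exists>g p. last_run w i g p \<and> g + last_group w i = Suc p \<and>
    TotalRep (length w) w i + card ((!) w ` {p<..<length w}) + Suc p = length w \<and>
    BigRep (length w) w i + card {x \<in> (!) w ` {p<..<length w}. i < x}
      = card {s. p < s \<and> s < length w \<and> i < w ! s}"
proof -
  let ?n = "length w"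
  define v where "v = takeWhile (\<lambda>x. x \<noteq> i) (rev w)"
  define u where "u = takeWhile (\<lambda>x. x = i) (dropWhile (\<lambda>x. x \<noteq> i) (rev w))"
  define r where "r = dropWhile (\<lambda>x. x = i) (dropWhile (\<lambda>x. x \<noteq> i) (rev w))"
  have "rev w = v @ u @ r" unfolding v_def u_def r_def by simp
  then have w: "w = rev r @ rev u @ rev v" by (metis append.assoc rev_append rev_rev_ident)
  have u: "set u \<subseteq> {i}" unfolding u_def by (auto dest: set_takeWhileD)
  have v: "i \<notin> set v" unfolding v_def by (auto dest: set_takeWhileD)
  have r: "r \<noteq> [] \<Longrightarrow> hd r \<noteq> i" unfolding r_def using hd_dropWhile by blast
  have "dropWhile (\<lambda>x. x \<noteq> i) (rev w) \<noteq> []" using assms(1) by (simp add: dropWhile_eq_Nil_conv)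
  then have "u \<noteq> []" unfolding u_def
    using hd_dropWhile[of "\<lambda>x. x \<noteq> i" "rev w"] by (cases "dropWhile (\<lambda>x. x \<noteq> i) (rev w)") auto
  define g where "g = length r"
  define p where "p = length r + length u - 1"
  have len: "?n = length r + length u + length v" using arg_cong[OF w, of length] by simp
  have pn: "Suc p = length r + length u" using \<open>u \<noteq> []\<close> unfolding p_def by (cases u) auto
  have drop: "rev v = drop (Suc p) w"
    using pn by (subst w) simp
  have set_v: "set v = (!) w ` {p<..<?n}"
  proof -
    have "set v = set (drop (Suc p) w)" using drop by (metis set_rev)
    also have "\<dots> = (!) w ` {Suc p..<?n}"
      by (metis append_Nil2 append_take_drop_id drop_upt image_set list.set_map map_nth add_0 drop_map set_upt)
    also have "{Suc p..<?n} = {p<..<?n}" by auto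
    finally show ?thesis .
  qed
  have run: "last_run w i g p"
    unfolding last_run_def
  proof (intro conjI allI impI; (elim conjE)?)
    show "g \<le> p" "p < ?n"
      using pn len \<open>u \<noteq> []\<close> unfolding g_def by (cases u; simp)+
    show "w ! s = i" if "g \<le> s" "s \<le> p" for s
    proof -
      have "s - g < length (rev u)" using that pn unfolding g_def by auto
      moreover from this have "w ! s = rev u ! (s - g)"
        using that(1) unfolding g_def by (subst w) (simp add: nth_append)
      ultimately have "w ! s \<in> set (rev u)" by (metis nth_mem)
      then show ?thesis using u by auto
    qed
    show "w ! s \<noteq> i" if "p < s" "s < ?n" for s
      using that v set_v by auto
    show "g = 0 \<or> w ! (g - 1) \<noteq> i"
    proof (cases "r = []")
      case False
      then have "w ! (g - 1) = hd r"
        unfolding g_def by (subst w) (simp add: nth_append rev_nth hd_conv_nth)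
      then show ?thesis using r[OF False] by simp
    qed (simp add: g_def)
  qed
  show ?thesis
  proof (intro exI conjI)
    show "last_run w i g p" by (rule run)
    show "g + last_group w i = Suc p"
      using pn unfolding g_def last_group_def u_def[symmetric] by simp
    have "(\<Sum>j\<in>{1..?n} - {i}. count_list v j - 1) + card (({1..?n} - {i}) \<inter> set v)
        = length (filter (\<lambda>x. x \<in> {1..?n} - {i}) v)" by (rule sum_count_list_pred) simp
    moreover have sub: "set v \<subseteq> {1..?n} - {i}" using v assms(2) set_v by auto
    then have "({1..?n} - {i}) \<inter> set v = set v" by auto
    moreover have "filter (\<lambda>x. x \<in> {1..?n} - {i}) v = v" using sub by (intro filter_True) auto
    ultimately show "TotalRep ?n w i + card ((!) w ` {p<..<?n}) + Suc p = ?n"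
      unfolding TotalRep_def count_right_def v_def[symmetric] set_v[symmetric] using len pn by simp
    have "(\<Sum>j\<in>{i+1..?n}. count_list v j - 1) + card ({i+1..?n} \<inter> set v)
        = length (filter (\<lambda>x. x \<in> {i+1..?n}) v)" by (rule sum_count_list_pred) simp
    moreover have "{i+1..?n} \<inter> set v = {x \<in> set v. i < x}" using sub by auto
    moreover have "length (filter (\<lambda>x. x \<in> {i+1..?n}) v) = card {s. p < s \<and> s < ?n \<and> i < w ! s}"
    proof -
      have "filter (\<lambda>x. x \<in> {i+1..?n}) v = filter (\<lambda>x. i < x) v"
        using sub by (intro filter_cong) auto
      also have "length \<dots> = length (filter (\<lambda>x. i < x) (drop (Suc p) w))"
        unfolding drop[symmetric] by (simp add: rev_filter[symmetric])
      also have "\<dots> = card {s. s < length (drop (Suc p) w) \<and> i < drop (Suc p) w ! s}"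
        by (rule length_filter_conv_card)
      also have "\<dots> = card ((\<lambda>s. s + Suc p) ` {s. s < length (drop (Suc p) w) \<and> i < drop (Suc p) w ! s})"
        by (rule card_image[symmetric]) (simp add: inj_on_def)
      also have "(\<lambda>s. s + Suc p) ` {s. s < length (drop (Suc p) w) \<and> i < drop (Suc p) w ! s}
          = {s. p < s \<and> s < ?n \<and> i < w ! s}"
      proof (intro set_eqI iffI)
        fix s assume "s \<in> {s. p < s \<and> s < ?n \<and> i < w ! s}"
        then show "s \<in> (\<lambda>s. s + Suc p) ` {s. s < length (drop (Suc p) w) \<and> i < drop (Suc p) w ! s}"
          by (intro image_eqI[of _ _ "s - Suc p"]) auto
      qed (auto simp: add.commute)
      finally show ?thesis .
    qed
    ultimately show "BigRep ?n w i + card {x \<in> (!) w ` {p<..<?n}. i < x}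
        = card {s. p < s \<and> s < ?n \<and> i < w ! s}"
      unfolding BigRep_def count_right_def v_def[symmetric] set_v[symmetric] by simp
  qed
qed

section \<open>Patterns and last groups\<close>

lemma avoids_2_1_2D:
  "avoids_2_1_2 w \<Longrightarrow> p \<le> q \<Longrightarrow> q \<le> r \<Longrightarrow> r < length w \<Longrightarrow> w ! p = w ! r \<Longrightarrow> w ! p \<le> w ! q"
  unfolding avoids_2_1_2_def by (metis le_neq_implies_less not_le order_refl)

lemma avoids_23_bar2_1_last:
  assumes "avoids_23_bar2_1 w" "w ! p < w ! Suc p" "\<And>s. p < s \<Longrightarrow> s < length w \<Longrightarrow> w ! s \<noteq> w ! p"
    and "p < q" "q < length w"
  shows "w ! p < w ! q"
proof (cases "q = Suc p")
  case False
  show ?thesis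
  proof (rule ccontr)
    assume "\<not> w ! p < w ! q"
    then have "w ! q < w ! p" using assms(3)[OF assms(4,5)] by simp
    then obtain s where "p + 1 < s" "s < q" "w ! s = w ! p"
      using assms(1,2,4,5) False unfolding avoids_23_bar2_1_def by (metis Suc_eq_plus1 Suc_lessI)
    then show False using assms(3)[of s] assms(5) by auto
  qed
qed (use assms in simp)

text \<open>
  The end \<open>t'\<close> of the run of equal letters that contains the position \<open>t\<close>.
\<close>

lemma obtain_run_end:
  fixes w :: "nat list"
  assumes "t < s" "w ! s \<noteq> w ! t"
  obtains t' where "t \<le> t'" "t' < s" "w ! t' = w ! t" "w ! Suc t' \<noteq> w ! t"
proof -
  define s' where "s' = (LEAST s. t < s \<and> w ! s \<noteq> w ! t)"
  have s': "t < s'" "w ! s' \<noteq> w ! t" "s' \<le> s"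
    using LeastI[of "\<lambda>s. t < s \<and> w ! s \<noteq> w ! t" s] Least_le[of "\<lambda>s. t < s \<and> w ! s \<noteq> w ! t" s] assms
    unfolding s'_def by auto
  have "w ! (s' - 1) = w ! t"
  proof (cases "s' - 1 = t")
    case False
    then have "t < s' - 1" "s' - 1 < s'" using s'(1) by auto
    then show ?thesis using not_less_Least[of "s' - 1" "\<lambda>s. t < s \<and> w ! s \<noteq> w ! t"] unfolding s'_def by auto
  qed simp
  then show thesis using that[of "s' - 1"] s' by auto
qed

text \<open>
  The labels greater than \<open>i\<close> that do not occur as letters; \<open>z(i)\<close> is their number.
\<close>

definition zero_labels :: "nat list \<Rightarrow> nat \<Rightarrow> nat set" where
  "zero_labels w i = {j. i < j \<and> j \<le> length w} - set w"

lemma finite_zero_labels: "finite (zero_labels w i)"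
  unfolding zero_labels_def by simp

lemma zeros_after_eq:
  assumes "has_content (length w) k w"
  shows "zeros_after (length w) k i = card (zero_labels w i)"
proof -
  have "k j = 0 \<longleftrightarrow> j \<notin> set w" if "i < j" "j \<le> length w" for j
    using assms that unfolding has_content_def by (metis atLeastAtMost_iff count_list_0_iff One_nat_def Suc_leI bot_nat_0.not_eq_extremum less_nat_zero_code)
  then show ?thesis unfolding zeros_after_def zero_labels_def by (intro arg_cong[of _ _ card]) auto
qed

locale bijective_word = letter_word +
  assumes bij: "bij_betw (outer_label w) {0..length w} {0..length w}"
begin

sublocale labelled_word w
  using w_ne w_letters bij by unfold_locales

lemma outer_label_le: "t \<le> length w \<Longrightarrow> outer_label w t \<le> length w"
  using bij_betw_apply[OF bij, of t] by simp

lemma card_image_outer_label: "g \<le> length w \<Longrightarrow> card (outer_label w ` {g..length w}) = Suc (length w) - g"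
  using bij by (subst card_image) (auto simp: bij_betw_def intro: inj_on_subset)

end

section \<open>Necessity of the conditions\<close>

text \<open>
  A word that is read by a \<open>\<psi>\<close> slide labeling.
\<close>

locale psi_word = bijective_word +
  assumes between: "\<And>p. p < length w \<Longrightarrow> leaf_between w p"
    and min_left: "\<And>p. p < length w \<Longrightarrow> min_on_left w p"
begin

lemma leaf_position:
  assumes "p < length w" "t \<le> length w" "outer_label w t = w ! p"
  shows "p \<le> t" "\<And>s. p < s \<Longrightarrow> s \<le> t \<Longrightarrow> s < length w \<Longrightarrow> w ! p \<le> w ! s"
proof -
  obtain t' where t': "p \<le> t'" "t' \<le> length w" "outer_label w t' = w ! p"
    "\<forall>s. p < s \<and> s \<le> t' \<and> s < length w \<longrightarrow> w ! p \<le> w ! s"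
    using between[OF assms(1)] unfolding leaf_between_def by blast
  have "t' = t" using inj[OF t'(2) assms(2)] t'(3) assms(3) by simp
  then show "p \<le> t" "\<And>s. p < s \<Longrightarrow> s \<le> t \<Longrightarrow> s < length w \<Longrightarrow> w ! p \<le> w ! s"
    using t' by auto
qed

lemma obtain_leaf:
  assumes "p < length w"
  obtains t where "t \<le> length w" "outer_label w t = w ! p" "p \<le> t"
  using ex_leaf[OF letter_le(1)[OF assms]] leaf_position(1)[OF assms] by blast

lemma avoids_212: "avoids_2_1_2 w"
  unfolding avoids_2_1_2_def
proof
  assume "\<exists>p q r. p < q \<and> q < r \<and> r < length w \<and> w ! p = w ! r \<and> w ! q < w ! r"
  then obtain p q r where *: "p < q" "q < r" "r < length w" "w ! p = w ! r" "w ! q < w ! r" by blast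
  obtain t where "t \<le> length w" "outer_label w t = w ! r" "r \<le> t" using obtain_leaf[OF *(3)] .
  then have "w ! p \<le> w ! q" using leaf_position(2)[of p t q] * by auto
  then show False using * by simp
qed

text \<open>
  The condition \<open>min_on_left\<close> for the edge to the right of a nondescent leaf \<open>t\<close>: the block to the
  left of that edge consists of the leaf \<open>t\<close> alone.
\<close>

lemma ascent_label_le:
  assumes "ascent w t" "t < b" "b \<le> length w" "outer_label w b \<noteq> w ! Suc t"
  shows "outer_label w t \<le> outer_label w b"
proof -
  have t: "Suc t < length w" "w ! t \<le> w ! Suc t" using assms(1) by (auto simp: ascent_def)
  obtain a where "t \<le> a" "a < Suc t"
    "\<forall>b. Suc t \<le> b \<and> b \<le> length w \<and> outer_label w b \<noteq> w ! Suc t \<longrightarrow> outer_label w a \<le> outer_label w b"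
    using min_left[OF t(1)] t(2) unfolding min_on_left_def by (metis lessI less_antisym not_less_eq)
  then show ?thesis using assms(2-4) by (metis Suc_leI le_antisym less_Suc_eq_le)
qed

lemma avoids_23_bar_2_1: "avoids_23_bar2_1 w"
  unfolding avoids_23_bar2_1_def
proof (intro allI impI, rule ccontr)
  fix p q0
  assume q0: "p + 1 < q0 \<and> q0 < length w \<and> w ! q0 < w ! p \<and> w ! p < w ! (p + 1)"
    and no: "\<nexists>s. p + 1 < s \<and> s < q0 \<and> w ! s = w ! p"
  \<comment> \<open>Replace \<open>q0\<close> by the first letter smaller than \<open>w ! p\<close>, so that all letters in between are larger.\<close>
  let ?P = "\<lambda>q. p + 1 < q \<and> w ! q < w ! p"
  define q where "q = (LEAST q. ?P q)"
  have q: "p + 1 < q" "w ! q < w ! p" "q \<le> q0"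
    using LeastI[of ?P q0] Least_le[of ?P q0] q0 unfolding q_def by auto
  have qn: "q < length w" using q(3) q0 by simp
  have gap: "w ! p < w ! s" if "p < s" "s < q" for s
  proof (cases "s = p + 1")
    case False
    then have "\<not> w ! s < w ! p" using not_less_Least[of s ?P] that unfolding q_def by auto
    moreover have "w ! s \<noteq> w ! p" using no that False q(3) by auto
    ultimately show ?thesis by simp
  qed (use q0 in simp)
  have "p < length w" using q(1) qn by simp
  then obtain t where t: "t \<le> length w" "outer_label w t = w ! p" "p \<le> t" using obtain_leaf by blast
  have "t < q" using leaf_position(2)[OF \<open>p < length w\<close> t(1,2), of q] q qn by (auto simp: not_le[symmetric])
  have "t \<noteq> q - 1"
  proof
    assume "t = q - 1"
    moreover have "w ! p < w ! (q - 1)" using gap[of "q - 1"] q(1) by simp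
    then have "descent w (q - 1)" using q qn by (simp add: descent_def)
    ultimately have "w ! (q - 1) = w ! p" using t(2) outer_label_descent by simp
    then show False using \<open>w ! p < w ! (q - 1)\<close> by simp
  qed
  then have "Suc t < q" using \<open>t < q\<close> by simp
  \<comment> \<open>The leaf \<open>t\<close> labelled \<open>w ! p\<close> is a nondescent leaf followed by a letter greater than
    \<open>w ! p\<close>, although the smaller label \<open>w ! q\<close> lies further right.\<close>
  have "\<not> descent w t"
  proof
    assume d: "descent w t"
    then have "w ! t = w ! p" using t(2) outer_label_descent by simp
    then have "t = p" using gap[of t] t(3) \<open>t < q\<close> by (metis le_neq_implies_less less_irrefl)
    then show False using d q0 qn by (simp add: descent_def)
  qed
  then have asc: "ascent w t" using not_descent_iff \<open>t < q\<close> qn by simp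
  obtain b where b: "b \<le> length w" "outer_label w b = w ! q" "q \<le> b" using obtain_leaf[OF qn] .
  have "outer_label w b \<noteq> w ! Suc t" using gap[of "Suc t"] \<open>Suc t < q\<close> t(3) b(2) q(2) by simp
  then have "w ! p \<le> w ! q" using ascent_label_le[OF asc _ b(1)] b t(2) \<open>t < q\<close> by simp
  then show False using q(2) by simp
qed

text \<open>
  A label greater than \<open>i = w ! p\<close> that is not a letter does not lie to the left of the last group
  of \<open>i\<close>'s, which starts at \<open>g\<close>.
\<close>

lemma zero_label_position:
  assumes "p < length w" "g \<le> p" "g = 0 \<or> w ! (g - 1) \<noteq> w ! p" "w ! g = w ! p"
    and j: "outer_label w t \<in> zero_labels w (w ! p)" and t: "t \<le> length w"
  shows "g \<le> t"
proof (rule ccontr)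
  assume "\<not> g \<le> t"
  then have tg: "t < g" by simp
  let ?i = "w ! p"
  have ij: "?i < outer_label w t" and jw: "outer_label w t \<notin> set w" using j by (auto simp: zero_labels_def)
  have tn: "t < length w" using tg assms by simp
  have "\<not> descent w t" using outer_label_descent jw tn nth_mem by metis
  then have asc: "ascent w t" using not_descent_iff tn by simp
  obtain ti where ti: "ti \<le> length w" "outer_label w ti = ?i" "p \<le> ti" using obtain_leaf[OF assms(1)] .
  \<comment> \<open>The label \<open>i\<close> lies further right and is smaller than the label of \<open>t\<close>, so it must be the exception,
    that is, the letter on the next edge.\<close>
  have y: "w ! Suc t = ?i" using ascent_label_le[OF asc _ ti(1)] ti ij tg assms(2) by fastforce
  have "w ! t \<le> ?i" using asc y by (simp add: ascent_def)
  moreover have "\<not> w ! t < ?i"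
  proof
    assume h: "w ! t < ?i"
    obtain b where b: "b \<le> length w" "outer_label w b = w ! t" "t \<le> b" using obtain_leaf[OF tn] .
    have "b \<noteq> t" using b(2) jw tn nth_mem by metis
    then have "outer_label w t \<le> w ! t" using ascent_label_le[OF asc _ b(1)] b h y by simp
    then show False using h ij by simp
  qed
  ultimately have wt: "w ! t = ?i" by simp
  have "t \<noteq> g - 1" using wt assms(3) tg by auto
  moreover have "Suc t \<noteq> g - 1" using y assms(3) tg by auto
  ultimately have "Suc t < g - 1" using tg by linarith
  moreover have "w ! (g - 1) \<noteq> w ! Suc t" using y assms(3) tg by auto
  ultimately obtain t' where t': "Suc t \<le> t'" "t' < g - 1" "w ! t' = w ! Suc t" "w ! Suc t' \<noteq> w ! Suc t"
    using obtain_run_end by metis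
  have "?i \<le> w ! Suc t'"
    using avoids_2_1_2D[OF avoids_212, of t' "Suc t'" p] t' y assms(1,2) by simp
  \<comment> \<open>The leaf at the end \<open>t'\<close> of this earlier run of \<open>i\<close>'s would have a label smaller than \<open>i\<close>, hence
    smaller than that of \<open>t\<close>.\<close>
  then have asc': "ascent w t'" using t' y assms(1,2) by (simp add: ascent_def)
  have 1: "outer_label w t' \<le> ?i"
    using ascent_label_le[OF asc' _ ti(1)] ti t' y assms(2) by simp
  have "outer_label w t' \<noteq> ?i" using inj[of t' ti] ti t' assms(1,2) by auto
  then have "outer_label w t \<le> outer_label w t'"
    using ascent_label_le[OF asc, of t'] t' y assms(1,2) by simp
  then show False using 1 ij by simp
qed

lemma zero_labels_subset:
  assumes "p < length w" "g \<le> p" "g = 0 \<or> w ! (g - 1) \<noteq> w ! p" "w ! g = w ! p"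
  shows "zero_labels w (w ! p) \<subseteq> outer_label w ` {g..length w}"
proof
  fix j assume j: "j \<in> zero_labels w (w ! p)"
  then obtain t where t: "t \<le> length w" "outer_label w t = j"
    using ex_leaf[of j] by (auto simp: zero_labels_def)
  then show "j \<in> outer_label w ` {g..length w}"
    using zero_label_position[OF assms _ t(1)] j by auto
qed

lemma suffix_letters_subset:
  assumes "g \<le> p"
  shows "(!) w ` {p..<length w} \<subseteq> outer_label w ` {g..length w}"
proof
  fix x assume "x \<in> (!) w ` {p..<length w}"
  then obtain s where s: "p \<le> s" "s < length w" "x = w ! s" by auto
  obtain t where "t \<le> length w" "outer_label w t = w ! s" "s \<le> t" using obtain_leaf[OF s(2)] .
  then show "x \<in> outer_label w ` {g..length w}" using s(1,3) assms by (intro image_eqI[of _ _ t]) auto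
qed

lemma zeros_le_TotalRep:
  assumes "i \<in> set w"
  shows "card (zero_labels w i) \<le> TotalRep (length w) w i + last_group w i"
proof -
  let ?n = "length w"
  obtain g p where run: "last_run w i g p" "g + last_group w i = Suc p"
    "TotalRep ?n w i + card ((!) w ` {p<..<?n}) + Suc p = ?n"
    "BigRep ?n w i + card {x \<in> (!) w ` {p<..<?n}. i < x} = card {s. p < s \<and> s < ?n \<and> i < w ! s}"
    using ex_last_run[OF assms w_letters] by blast
  note gp = last_runD[OF run(1)]
  have wp: "w ! p = i" "w ! g = i" using gp by auto
  let ?S = "(!) w ` {p<..<?n}" and ?Z = "zero_labels w i"
  have "insert i ?S \<subseteq> (!) w ` {p..<?n}" using gp(2) wp(1) by fastforce
  then have "insert i ?S \<union> ?Z \<subseteq> outer_label w ` {g..?n}"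
    using suffix_letters_subset[OF gp(1)] zero_labels_subset[OF gp(2,1)] gp(5) wp by auto
  then have "card (insert i ?S \<union> ?Z) \<le> card (outer_label w ` {g..?n})"
    by (intro card_mono) auto
  moreover have "card (insert i ?S \<union> ?Z) = Suc (card ?S) + card ?Z"
  proof -
    have "insert i ?S \<inter> ?Z = {}" using assms nth_mem by (fastforce simp: zero_labels_def)
    moreover have "i \<notin> ?S" by (metis gp(4) greaterThanLessThan_iff imageE)
    ultimately show ?thesis by (subst card_Un_disjoint) (auto simp: finite_zero_labels)
  qed
  ultimately show ?thesis using card_image_outer_label[of g] gp(1,2) run(2,3) by simp
qed

end

text \<open>
  A word that is read by an \<open>\<omega>\<close> slide labeling.
\<close>

locale omega_word = psi_word +
  assumes smaller: "\<And>p. p < length w \<Longrightarrow> smaller_on_right w p"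
begin

text \<open>
  Among the edges from \<open>s\<close> on whose letters are smaller than \<open>i\<close>, every two consecutive ones have a
  leaf with a label smaller than \<open>i\<close> between them, and the last one has two such leaves to its right.
\<close>

lemma card_smaller_labels:
  assumes "s < length w" "w ! s < i"
  shows "Suc (card {s'. s \<le> s' \<and> s' < length w \<and> w ! s' < i})
     \<le> card {t. s \<le> t \<and> t \<le> length w \<and> outer_label w t < i}"
  using assms
proof (induction "length w - s" arbitrary: s rule: less_induct)
  case less
  let ?n = "length w"
  let ?L = "\<lambda>s. {t. s \<le> t \<and> t \<le> ?n \<and> outer_label w t < i}"
  let ?S = "\<lambda>s. {s'. s \<le> s' \<and> s' < ?n \<and> w ! s' < i}"
  obtain ts where ts: "ts \<le> ?n" "outer_label w ts = w ! s" "s \<le> ts" using obtain_leaf[OF less.prems(1)] .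
  show ?case
  proof (cases "\<exists>s'. s < s' \<and> s' < ?n \<and> w ! s' < i")
    case False
    then have "?S s = {s}" using less.prems by (auto simp: order_le_less)
    moreover obtain b where b: "s \<le> b" "b \<le> ?n" "outer_label w b < w ! s"
      using smaller[OF less.prems(1)] unfolding smaller_on_right_def by blast
    then have "ts \<noteq> b" using ts by auto
    then have "{ts, b} \<subseteq> ?L s" "card {ts, b} = 2" using b ts less.prems by auto
    moreover from this have "card {ts, b} \<le> card (?L s)" by (intro card_mono) auto
    ultimately show ?thesis by simp
  next
    case True
    let ?P = "\<lambda>s'. s < s' \<and> s' < ?n \<and> w ! s' < i"
    define s' where "s' = (LEAST s'. ?P s')"
    have s': "?P s'" using True unfolding s'_def by (rule LeastI_ex)
    have gap: "i \<le> w ! r" if "s < r" "r < s'" for r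
      using not_less_Least[of r ?P] that s' unfolding s'_def by auto
    have "?S s = insert s (?S s')"
    proof (intro equalityI subsetI)
      fix r assume r: "r \<in> ?S s"
      then show "r \<in> insert s (?S s')" using gap[of r] by (cases "r = s"; cases "r < s'") auto
    qed (use s' less.prems in auto)
    then have cS: "card (?S s) = Suc (card (?S s'))" using s' by simp
    have IH: "Suc (card (?S s')) \<le> card (?L s')" using s' by (intro less.hyps) auto
    \<comment> \<open>If the letter at the next small edge \<open>s'\<close> is not smaller than that at \<open>s\<close>, the leaf is the
      minimum to the left of \<open>s'\<close>; otherwise it is the one labelled \<open>w ! s\<close>.\<close>
    have "\<exists>a. s \<le> a \<and> a < s' \<and> outer_label w a < i"
    proof (cases "w ! s \<le> w ! s'")
      case True
      have "\<forall>r. s < r \<and> r < s' \<longrightarrow> w ! s' < w ! r" using gap s' by fastforce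
      then obtain a where a: "s \<le> a" "a < s'"
        "\<forall>b. s' \<le> b \<and> b \<le> ?n \<and> outer_label w b \<noteq> w ! s' \<longrightarrow> outer_label w a \<le> outer_label w b"
        using min_left[of s'] True s' unfolding min_on_left_def by blast
      obtain b where "s' \<le> b" "b \<le> ?n" "outer_label w b < w ! s'"
        using smaller[of s'] s' unfolding smaller_on_right_def by blast
      then have "outer_label w a < w ! s'" using a(3) by (metis le_less_trans less_irrefl)
      then show ?thesis using a(1,2) s' by (meson less_trans)
    next
      case False
      then have "ts < s'" using leaf_position(2)[OF less.prems(1) ts(1,2), of s'] s'
        by (auto simp: not_le[symmetric])
      then show ?thesis using ts less.prems by auto
    qed
    then obtain a where a: "s \<le> a" "a < s'" "outer_label w a < i" by blast
    have "insert a (?L s') \<subseteq> ?L s" using a s' by auto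
    then have "card (insert a (?L s')) \<le> card (?L s)" by (intro card_mono) auto
    then show ?thesis using cS IH a(2) by simp
  qed
qed

lemma zeros_le_BigRep:
  assumes "i \<in> set w"
  shows "card (zero_labels w i) \<le> BigRep (length w) w i"
proof -
  let ?n = "length w"
  obtain g p where run: "last_run w i g p" "g + last_group w i = Suc p"
    "TotalRep ?n w i + card ((!) w ` {p<..<?n}) + Suc p = ?n"
    "BigRep ?n w i + card {x \<in> (!) w ` {p<..<?n}. i < x} = card {s. p < s \<and> s < ?n \<and> i < w ! s}"
    using ex_last_run[OF assms w_letters] by blast
  note gp = last_runD[OF run(1)]
  have wp: "w ! p = i" "w ! g = i" using gp by auto
  let ?B = "{x \<in> (!) w ` {p<..<?n}. i < x}" and ?Z = "zero_labels w i"
  let ?L = "{t. p \<le> t \<and> t \<le> ?n \<and> outer_label w t < i}" and ?S = "{s. p < s \<and> s < ?n \<and> w ! s < i}"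
  obtain b where b: "p \<le> b" "b \<le> ?n" "outer_label w b < i"
    using smaller[OF gp(2)] wp(1) unfolding smaller_on_right_def by auto
  have Z: "?Z \<subseteq> outer_label w ` {p..?n}"
  proof
    fix j assume j: "j \<in> ?Z"
    then have "j \<in> zero_labels w (w ! p)" using wp by simp
    then obtain t where t: "g \<le> t" "t \<le> ?n" "outer_label w t = j"
      using zero_labels_subset[OF gp(2,1)] gp(5) wp by fastforce
    have "\<not> t < p"
    proof
      assume "t < p"
      then have eq: "w ! t = i" "w ! Suc t = i" using gp(3) t(1) by auto
      then have asc: "ascent w t" using \<open>t < p\<close> gp(2) by (simp add: ascent_def)
      have "outer_label w t \<le> outer_label w b"
        using ascent_label_le[OF asc _ b(2)] b eq \<open>t < p\<close> by simp
      then show False using b(3) t(3) j by (simp add: zero_labels_def)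
    qed
    then show "j \<in> outer_label w ` {p..?n}" using t by auto
  qed
  have L: "Suc (card ?S) \<le> card ?L"
  proof (cases "?S = {}")
    case True
    have "b \<in> ?L" using b by simp
    then have "card {b} \<le> card ?L" by (intro card_mono) auto
    then show ?thesis unfolding True by simp
  next
    case False
    then obtain s0 where s0: "p < s0 \<and> s0 < ?n \<and> w ! s0 < i" by auto
    let ?P = "\<lambda>s. p < s \<and> s < ?n \<and> w ! s < i"
    define s where "s = (LEAST s. ?P s)"
    have s: "?P s" unfolding s_def using s0 by (rule LeastI[of ?P])
    have "?S = {s'. s \<le> s' \<and> s' < ?n \<and> w ! s' < i}"
      using Least_le[of ?P] s unfolding s_def[symmetric] by auto
    then have "Suc (card ?S) \<le> card {t. s \<le> t \<and> t \<le> ?n \<and> outer_label w t < i}"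
      using card_smaller_labels[of s i] s by simp
    also have "\<dots> \<le> card ?L" using s by (intro card_mono) auto
    finally show ?thesis .
  qed
  have "inj_on (outer_label w) ?L"
    using bij by (auto simp: bij_betw_def intro: inj_on_subset)
  then have cL: "card (outer_label w ` ?L) = card ?L" by (rule card_image)
  have "?B \<union> {i} \<subseteq> (!) w ` {p..<?n}" using gp(2) wp(1) by fastforce
  then have "outer_label w ` ?L \<union> (?B \<union> {i} \<union> ?Z) \<subseteq> outer_label w ` {p..?n}"
    using Z suffix_letters_subset[of p p] by auto
  then have "card (outer_label w ` ?L \<union> (?B \<union> {i} \<union> ?Z)) \<le> card (outer_label w ` {p..?n})"
    by (intro card_mono) auto
  moreover have "card (outer_label w ` ?L \<union> (?B \<union> {i} \<union> ?Z)) = card ?L + (Suc (card ?B) + card ?Z)"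
  proof -
    have "?B \<inter> ?Z = {}" using nth_mem by (fastforce simp: zero_labels_def)
    then have "(?B \<union> {i}) \<inter> ?Z = {}" by (auto simp: zero_labels_def)
    then have "card (?B \<union> {i} \<union> ?Z) = Suc (card ?B) + card ?Z"
      by (subst card_Un_disjoint) (auto simp: finite_zero_labels)
    moreover have "outer_label w ` ?L \<inter> (?B \<union> {i} \<union> ?Z) = {}" by (auto simp: zero_labels_def)
    ultimately show ?thesis unfolding cL[symmetric]
      by (subst card_Un_disjoint) (auto simp: finite_zero_labels)
  qed
  moreover have "?n - Suc p = card ?S + card {s. p < s \<and> s < ?n \<and> i < w ! s}"
  proof -
    have "{p<..<?n} = ?S \<union> {s. p < s \<and> s < ?n \<and> i < w ! s}" using gp(4) by force
    then have "card {p<..<?n} = card (?S \<union> {s. p < s \<and> s < ?n \<and> i < w ! s})" by simp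
    also have "\<dots> = card ?S + card {s. p < s \<and> s < ?n \<and> i < w ! s}"
      by (rule card_Un_disjoint) auto
    finally show ?thesis by simp
  qed
  ultimately show ?thesis using L card_image_outer_label[of p] gp(2) run(4) by simp
qed

end

section \<open>Sufficiency of the conditions\<close>

text \<open>
  A word that satisfies the pattern conditions and the inequality for \<open>\<psi>\<close>; the inequality for \<open>\<omega>\<close>
  is stronger.
\<close>

locale avoiding_word = letter_word +
  assumes av212: "avoids_2_1_2 w" and av23: "avoids_23_bar2_1 w"
    and zeros_le: "\<And>i. i \<in> set w \<Longrightarrow> card (zero_labels w i) \<le> TotalRep (length w) w i + last_group w i"
begin

sublocale bijective_word w
  using bij_outer_label[OF av212] by unfold_locales

lemma ex_last:
  "u \<in> set w \<Longrightarrow> \<exists>q<length w. w ! q = u \<and> (\<forall>s. q < s \<and> s < length w \<longrightarrow> w ! s \<noteq> u)"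
  using ex_last_run[OF _ w_letters, of u] unfolding last_run_def by blast

text \<open>
  After the last occurrence of a letter, if the leaf there is not a descent leaf, all letters are
  larger.
\<close>

lemma after_last_greater:
  assumes "q < length w" "\<And>s. q < s \<Longrightarrow> s < length w \<Longrightarrow> w ! s \<noteq> w ! q" "\<not> descent w q"
    and "q < s" "s < length w"
  shows "w ! q < w ! s"
proof -
  have "ascent w q" using not_descent_iff assms(1,3) by simp
  then have "w ! q < w ! Suc q" using assms(2)[of "Suc q"] by (auto simp: ascent_def order_le_less)
  then show ?thesis using avoids_23_bar2_1_last[OF av23 _ assms(2) assms(4,5)] by simp
qed

lemma unused_not_descent: "u \<in> unused w t \<Longrightarrow> w ! q = u \<Longrightarrow> \<not> descent w q"
  unfolding unused_def descent_labels_eq by auto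

text \<open>
  A label \<open>y\<close> that is passed over at \<open>t\<close> because the next edge carries \<open>y\<close> is used at the latest at
  the end of the run of \<open>y\<close>'s that starts there.
\<close>

lemma delayed_label:
  assumes asc: "ascent w t" and y: "w ! Suc t < outer_label w t" "w ! Suc t \<in> unused w t"
    and s: "Suc t < s" "s < length w" "w ! s \<noteq> w ! Suc t"
    and b: "b \<le> length w" "outer_label w b = w ! Suc t"
  shows "b < s"
proof (rule ccontr)
  assume "\<not> b < s"
  let ?y = "w ! Suc t"
  obtain t' where t': "Suc t \<le> t'" "t' < s" "w ! t' = ?y" "w ! Suc t' \<noteq> ?y"
    using obtain_run_end[OF s(1,3)] .
  have asc': "ascent w t'" using unused_not_descent[OF y(2) t'(3)] not_descent_iff t'(2) s(2) by simp
  have V: "outer_label w t' \<in> unused w t'" "unused w t' \<subseteq> unused w t"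
    using outer_label_ascent(1)[OF asc'] unused_mono[of t t'] t'(1) by auto
  have "?y \<in> unused w t'"
  proof -
    have ne: "outer_label w r \<noteq> ?y" if "r < t'" for r
      using inj[of r b] that t' s b \<open>\<not> b < s\<close> by auto
    have "?y \<notin> {outer_label w r | r. r < t' \<and> ascent w r}"
    proof
      assume "?y \<in> {outer_label w r | r. r < t' \<and> ascent w r}"
      then obtain r where "r < t'" "?y = outer_label w r" by blast
      then show False using ne[of r] by simp
    qed
    then show ?thesis using y(2) unfolding unused_def by simp
  qed
  then have "outer_label w t' \<le> ?y" using outer_label_ascent(3)[OF asc', of ?y] t'(4) by simp
  moreover have "outer_label w t' \<noteq> ?y" using inj[of t' b] b t' s \<open>\<not> b < s\<close> by auto
  then have "outer_label w t \<le> outer_label w t'" using outer_label_ascent(3)[OF asc] V by auto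
  ultimately show False using y(1) by simp
qed

text \<open>
  The main counting lemma.  If a nondescent leaf \<open>t\<close> has a label at least \<open>e = w ! p\<close> and lies well
  to the left of the last group \<open>g, \<dots>, p\<close> of \<open>e\<close>'s, then the leaves from \<open>g\<close> on can only carry \<open>e\<close>,
  letters to the right of \<open>p\<close>, and non-letters greater than \<open>e\<close>: the greedy choice has used up
  everything else.
\<close>

lemma labels_from_last_group:
  assumes asc: "ascent w t" and e: "w ! p \<le> outer_label w t"
    and p: "p < length w" "\<And>s. p < s \<Longrightarrow> s < length w \<Longrightarrow> w ! s \<noteq> w ! p"
    and g: "g \<le> p" "\<And>s. g \<le> s \<Longrightarrow> s \<le> p \<Longrightarrow> w ! s = w ! p" "Suc t < g"
    and t': "g \<le> t'" "t' \<le> length w"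
  shows "outer_label w t' \<in> insert (w ! p) ((!) w ` {p<..<length w}) \<union> zero_labels w (w ! p)"
proof -
  let ?e = "w ! p" and ?u = "outer_label w t'" and ?y = "w ! Suc t"
  let ?S = "(!) w ` {p<..<length w}"
  show ?thesis
  proof (cases "descent w t'")
    case True
    then have "?u = w ! t'" "t' < length w" by (auto simp: outer_label_descent descent_def)
    then show ?thesis using g(2)[of t'] t'(1) by (cases "t' \<le> p") auto
  next
    case False
    have V: "?u \<in> unused w t"
      using outer_label_not_descent[OF t'(2) False] unused_mono[of t t'] g(3) t'(1) by auto
    have u_le: "outer_label w t \<le> ?u" if "?u \<noteq> ?y" using outer_label_ascent(3)[OF asc V that] .
    show ?thesis
    proof (cases "?u \<in> set w")
      case False
      have "?y \<in> set w" using asc by (simp add: ascent_def)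
      then have "?u \<noteq> ?y" "?u \<noteq> ?e" using False p(1) by auto
      then have "?e < ?u" using u_le e by simp
      then show ?thesis using False outer_label_le[OF t'(2)] by (simp add: zero_labels_def)
    next
      case True
      obtain q where q: "q < length w" "w ! q = ?u" "\<forall>s. q < s \<and> s < length w \<longrightarrow> w ! s \<noteq> ?u"
        using ex_last[OF True] by blast
      consider "p < q" | "q = p" | "q < p" by linarith
      then show ?thesis
      proof cases
        case 1
        then show ?thesis using q by (metis UnI1 greaterThanLessThan_iff imageI insertI2)
      next
        case 2
        then show ?thesis using q by simp
      next
        case 3
        have "?u < ?e"
          using after_last_greater[OF q(1) _ unused_not_descent[OF V q(2)] 3 p(1)] q by simp
        then have y: "?u = ?y" using u_le e by force
        moreover have "w ! g = ?e" using g(2)[of g] g(1) by simp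
        ultimately have "t' < g"
          using delayed_label[OF asc, of g t'] V \<open>?u < ?e\<close> e g(1,3) p(1) t'(2) by simp
        then show ?thesis using t'(1) by simp
      qed
    qed
  qed
qed

lemma outer_label_last_occurrence:
  assumes p: "p < length w" "\<And>s. p < s \<Longrightarrow> s < length w \<Longrightarrow> w ! s \<noteq> w ! p"
  shows "\<exists>t. p \<le> t \<and> t \<le> length w \<and> outer_label w t = w ! p
    \<and> (\<forall>s. p < s \<and> s \<le> t \<and> s < length w \<longrightarrow> w ! p \<le> w ! s)"
proof (cases "descent w p")
  case True
  then show ?thesis using p(1) by (intro exI[of _ p]) (auto simp: outer_label_descent)
next
  case False
  let ?n = "length w"
  have gt: "w ! p < w ! s" if "p < s" "s < ?n" for s
    using after_last_greater[OF p False that] .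
  obtain t where t: "t \<le> ?n" "outer_label w t = w ! p" using ex_leaf[OF letter_le(1)[OF p(1)]] by blast
  \<comment> \<open>Otherwise the label \<open>w ! p\<close> itself is missing from the leaves of \<open>labels_from_last_group\<close>, and
    there are more leaves than labels for them.\<close>
  have "p \<le> t"
  proof (rule ccontr)
    assume "\<not> p \<le> t"
    then have tp: "t < p" by simp
    have "\<not> descent w t"
      using descent_last[OF av212 _ tp p(1)] t(2) outer_label_descent by metis
    then have asc: "ascent w t" using not_descent_iff tp p(1) by simp
    have y: "w ! Suc t \<noteq> w ! p" using outer_label_ascent(2)[OF asc] t(2) by simp
    have "w ! p \<in> set w" using p(1) by simp
    obtain g p' where run: "last_run w (w ! p) g p'" "g + last_group w (w ! p) = Suc p'"
      "TotalRep ?n w (w ! p) + card ((!) w ` {p'<..<?n}) + Suc p' = ?n"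
      "BigRep ?n w (w ! p) + card {x \<in> (!) w ` {p'<..<?n}. w ! p < x} = card {s. p' < s \<and> s < ?n \<and> w ! p < w ! s}"
      using ex_last_run[OF \<open>w ! p \<in> set w\<close> w_letters] by blast
    note gp = last_runD[OF run(1)]
    have "p' = p" using gp(3)[of p'] gp(1,2,4) p by (metis linorder_neqE_nat order_refl)
    note gp = gp[unfolded \<open>p' = p\<close>] and run = run[unfolded \<open>p' = p\<close>]
    have "Suc t < g" using y gp(3)[of "Suc t"] tp by (metis Suc_leI not_le)
    let ?S = "(!) w ` {p<..<?n}" and ?Z = "zero_labels w (w ! p)"
    have "outer_label w ` {g..?n} \<subseteq> ?S \<union> ?Z"
    proof
      fix x assume "x \<in> outer_label w ` {g..?n}"
      then obtain t' where t': "g \<le> t'" "t' \<le> ?n" "x = outer_label w t'" by auto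
      have "x \<noteq> w ! p" using inj[of t' t] t t' \<open>Suc t < g\<close> by auto
      then show "x \<in> ?S \<union> ?Z"
        using labels_from_last_group[OF asc _ p gp(1,3) \<open>Suc t < g\<close> t'(1,2)] t(2) t'(3) by auto
    qed
    then have "card (outer_label w ` {g..?n}) \<le> card (?S \<union> ?Z)"
      by (intro card_mono) (auto simp: finite_zero_labels)
    also have "\<dots> \<le> card ?S + card ?Z" by (rule card_Un_le)
    finally show False
      using card_image_outer_label[of g] gp(1,2) run(2,3) zeros_le[OF \<open>w ! p \<in> set w\<close>] by simp
  qed
  then show ?thesis using t gt by (intro exI[of _ t]) (auto intro: less_imp_le)
qed

lemma leaf_between: 
  assumes "p < length w"
  shows "leaf_between w p"
proof -
  obtain q where q: "q < length w" "w ! q = w ! p" "\<forall>s. q < s \<and> s < length w \<longrightarrow> w ! s \<noteq> w ! p"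
    using ex_last[OF nth_mem[OF assms]] by blast
  have "\<not> q < p" using q(3) assms by blast
  then have "p \<le> q" by simp
  obtain t where t: "q \<le> t" "t \<le> length w" "outer_label w t = w ! p"
    "\<forall>s. q < s \<and> s \<le> t \<and> s < length w \<longrightarrow> w ! p \<le> w ! s"
    using outer_label_last_occurrence[of q] q by metis
  have "w ! p \<le> w ! s" if "p < s" "s \<le> t" "s < length w" for s
    using t(4) that avoids_2_1_2D[OF av212, of p s q] q(1,2) by (cases "q < s") auto
  then show ?thesis unfolding leaf_between_def using t \<open>p \<le> q\<close> by (meson le_trans)
qed

text \<open>
  For a descent leaf \<open>b\<close> the greedy choice says nothing.  If its label \<open>e\<close> were smaller than the
  label \<open>m\<close> of \<open>t\<close>, then \<open>m\<close> would be a non-letter greater than \<open>e\<close> that is missing from the leaves of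
  \<open>labels_from_last_group\<close>, and again there are more leaves than labels.
\<close>

lemma ascent_label_le:
  assumes asc: "ascent w t" and b: "t < b" "b \<le> length w" "outer_label w b \<noteq> w ! Suc t"
  shows "outer_label w t \<le> outer_label w b"
proof (cases "descent w b")
  case False
  then have "outer_label w b \<in> unused w t"
    using outer_label_not_descent[OF b(2)] unused_mono[of t b] b(1) by auto
  then show ?thesis using outer_label_ascent(3)[OF asc] b(3) by simp
next
  case True
  let ?n = "length w"
  let ?m = "outer_label w t" and ?e = "w ! b"
  have e: "outer_label w b = ?e" "b < ?n" using True by (auto simp: outer_label_descent descent_def)
  have last: "\<And>s. b < s \<Longrightarrow> s < ?n \<Longrightarrow> w ! s \<noteq> ?e" using descent_last[OF av212 True] .
  show ?thesis
  proof (rule ccontr)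
    assume "\<not> ?thesis"
    then have em: "?e < ?m" using e by simp
    have "?e \<in> set w" using e(2) by simp
    obtain g p where run: "last_run w ?e g p" "g + last_group w ?e = Suc p"
      "TotalRep ?n w ?e + card ((!) w ` {p<..<?n}) + Suc p = ?n"
      "BigRep ?n w ?e + card {x \<in> (!) w ` {p<..<?n}. ?e < x} = card {s. p < s \<and> s < ?n \<and> ?e < w ! s}"
      using ex_last_run[OF \<open>?e \<in> set w\<close> w_letters] by blast
    note gp = last_runD[OF run(1)]
    have "p = b" using gp(3)[of p] gp(1,2,4) last e(2) by (metis linorder_neqE_nat order_refl)
    note gp = gp[unfolded \<open>p = b\<close>] and run = run[unfolded \<open>p = b\<close>]
    have tg: "Suc t < g" using b(1,3) e(1) gp(3)[of "Suc t"] by (metis Suc_leI not_le)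
    have tn: "t \<le> ?n" using asc by (simp add: ascent_def)
    have "?m \<notin> set w"
    proof
      assume m: "?m \<in> set w"
      obtain q where q: "q < ?n" "w ! q = ?m" "\<forall>s. q < s \<and> s < ?n \<longrightarrow> w ! s \<noteq> ?m"
        using ex_last[OF m] by blast
      obtain t' where "q \<le> t'" "t' \<le> ?n" "outer_label w t' = ?m"
        using leaf_between[OF q(1)] q(2) unfolding leaf_between_def by auto
      then have "q \<le> t" using inj[OF _ tn] by metis
      then have "q < b" using b(1) by simp
      then have "?m < ?e"
        using after_last_greater[OF q(1) _ unused_not_descent[OF outer_label_ascent(1)[OF asc] q(2)] _ e(2)] q
        by simp
      then show False using em by simp
    qed
    let ?S = "(!) w ` {b<..<?n}" and ?Z = "zero_labels w ?e"
    have mZ: "?m \<in> ?Z" using \<open>?m \<notin> set w\<close> em outer_label_le[OF tn] by (simp add: zero_labels_def)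
    have "outer_label w ` {g..?n} \<subseteq> insert ?e ?S \<union> (?Z - {?m})"
    proof
      fix x assume "x \<in> outer_label w ` {g..?n}"
      then obtain t' where t': "g \<le> t'" "t' \<le> ?n" "x = outer_label w t'" by auto
      have "x \<noteq> ?m" using inj[of t' t] tn t' tg by auto
      then show "x \<in> insert ?e ?S \<union> (?Z - {?m})"
        using labels_from_last_group[OF asc less_imp_le[OF em] e(2) last gp(1,3) tg t'(1,2)] t'(3) by auto
    qed
    then have "card (outer_label w ` {g..?n}) \<le> card (insert ?e ?S \<union> (?Z - {?m}))"
      by (intro card_mono) (auto simp: finite_zero_labels)
    also have "\<dots> \<le> card (insert ?e ?S) + card (?Z - {?m})" by (rule card_Un_le)
    also have "\<dots> \<le> Suc (card ?S) + (card ?Z - 1)"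
      using mZ finite_zero_labels by (intro add_mono card_insert_le_m1) (auto simp: card_insert_if card_Diff_singleton)
    also have "\<dots> = card ?S + card ?Z" using mZ finite_zero_labels by (simp add: card_gt_0_iff) (metis Suc_pred card_gt_0_iff empty_iff)
    finally show False
      using card_image_outer_label[of g] gp(1,2) run(2,3) zeros_le[OF \<open>?e \<in> set w\<close>] by simp
  qed
qed

lemma min_on_left:
  assumes p: "p < length w"
  shows "min_on_left w p"
  unfolding min_on_left_def
proof (intro allI impI)
  fix q assume "q < p" and "w ! q \<le> w ! p \<and> (\<forall>s. q < s \<and> s < p \<longrightarrow> w ! p < w ! s)"
  then have q: "q < p" "w ! q \<le> w ! p" "\<And>s. q < s \<Longrightarrow> s < p \<Longrightarrow> w ! p < w ! s" by auto
  have asc: "ascent w q"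
  proof (cases "Suc q = p")
    case False
    then have "Suc q < p" "w ! p < w ! Suc q" using q(1) q(3)[of "Suc q"] by auto
    then show ?thesis using q(2) p by (simp add: ascent_def)
  qed (use q p in \<open>auto simp: ascent_def\<close>)
  \<comment> \<open>The witness is the leaf \<open>q\<close>; the exceptional label in \<open>ascent_label_le\<close> does not lie right of \<open>p\<close>.\<close>
  have "outer_label w b \<noteq> w ! Suc q" if b: "p \<le> b" "b \<le> length w" "outer_label w b \<noteq> w ! p" for b
  proof
    assume y: "outer_label w b = w ! Suc q"
    have ne: "Suc q \<noteq> p" using y b(3) by auto
    then have qp: "Suc q < p" using q(1) by simp
    have "Suc q < length w" using qp p by simp
    from leaf_between[OF this]
    obtain t where "t \<le> length w" "outer_label w t = w ! Suc q"
      "\<forall>s. Suc q < s \<and> s \<le> t \<and> s < length w \<longrightarrow> w ! Suc q \<le> w ! s"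
      unfolding leaf_between_def by blast
    moreover from this have "t = b" using inj b(2) y by metis
    ultimately have "w ! Suc q \<le> w ! p" using qp b(1) p by blast
    then show False using q(3)[of "Suc q"] qp by simp
  qed
  then show "\<exists>a\<ge>q. a < p \<and>
     (\<forall>b. p \<le> b \<and> b \<le> length w \<and> outer_label w b \<noteq> w ! p \<longrightarrow> outer_label w a \<le> outer_label w b)"
    using ascent_label_le[OF asc] q(1) by (intro exI[of _ q]) auto
qed

text \<open>
  If no label to the right of \<open>r\<close> were smaller than \<open>i = w ! r\<close>, the leaves after the last \<open>i\<close> would
  only carry \<open>i\<close>, the letters after it, all larger than \<open>i\<close>, and non-letters greater than \<open>i\<close>.
\<close>

lemma smaller_on_right:
  assumes zeros: "\<And>i. i \<in> set w \<Longrightarrow> card (zero_labels w i) \<le> BigRep (length w) w i"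
    and r: "r < length w"
  shows "smaller_on_right w r"
proof (rule ccontr)
  assume none: "\<not> smaller_on_right w r"
  let ?n = "length w" and ?i = "w ! r"
  have "?i \<in> set w" using r by simp
  obtain g p where run: "last_run w ?i g p" "g + last_group w ?i = Suc p"
    "TotalRep ?n w ?i + card ((!) w ` {p<..<?n}) + Suc p = ?n"
    "BigRep ?n w ?i + card {x \<in> (!) w ` {p<..<?n}. ?i < x} = card {s. p < s \<and> s < ?n \<and> ?i < w ! s}"
    using ex_last_run[OF \<open>?i \<in> set w\<close> w_letters] by blast
  note gp = last_runD[OF run(1)]
  have wp: "w ! p = ?i" using gp(1,3) by simp
  have "r \<le> p" using gp(4)[of r] r by (meson not_le)
  then have ge: "?i \<le> outer_label w t" if "p \<le> t" "t \<le> ?n" for t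
    using none that unfolding smaller_on_right_def by (metis le_trans not_le)
  have gt: "?i < w ! s" if s: "p < s" "s < ?n" for s
  proof -
    obtain t where "s \<le> t" "t \<le> ?n" "outer_label w t = w ! s"
      using leaf_between[OF s(2)] unfolding leaf_between_def by blast
    then have "?i \<le> w ! s" using ge[of t] s(1) by simp
    then show ?thesis using gp(4)[OF s] by simp
  qed
  let ?S = "(!) w ` {p<..<?n}" and ?Z = "zero_labels w ?i"
  have "outer_label w ` {p..?n} \<subseteq> insert ?i ?S \<union> ?Z"
  proof
    fix u assume "u \<in> outer_label w ` {p..?n}"
    then obtain t where t: "p \<le> t" "t \<le> ?n" "u = outer_label w t" by auto
    have "?i \<le> u" using ge t by simp
    show "u \<in> insert ?i ?S \<union> ?Z"
    proof (cases "u \<in> set w")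
      case False
      then have "u \<noteq> ?i" using r by auto
      then show ?thesis using False \<open>?i \<le> u\<close> outer_label_le[OF t(2)] t(3) by (simp add: zero_labels_def)
    next
      case True
      then obtain q where q: "q < ?n" "w ! q = u" by (metis in_set_conv_nth)
      have "u = ?i" if "q < p"
      proof -
        obtain t' where "t' \<le> ?n" "outer_label w t' = u"
            "\<forall>s. q < s \<and> s \<le> t' \<and> s < ?n \<longrightarrow> u \<le> w ! s"
          using leaf_between[OF q(1)] q(2) unfolding leaf_between_def by blast
        moreover from this have "t' = t" using inj t by metis
        ultimately have "u \<le> w ! p" using that t(1) gp(2) by blast
        then show ?thesis using wp \<open>?i \<le> u\<close> by simp
      qed
      then show ?thesis using q wp by (cases "q < p"; cases "q = p") auto
    qed
  qed
  then have "card (outer_label w ` {p..?n}) \<le> card (insert ?i ?S \<union> ?Z)"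
    by (intro card_mono) (auto simp: finite_zero_labels)
  also have "\<dots> \<le> card (insert ?i ?S) + card ?Z" by (rule card_Un_le)
  also have "\<dots> \<le> Suc (card ?S) + card ?Z" by (simp add: card_insert_if)
  finally have "Suc ?n - p \<le> Suc (card ?S) + card ?Z" using card_image_outer_label[of p] gp(2) by simp
  moreover have "{x \<in> ?S. ?i < x} = ?S" using gt by auto
  moreover have "{s. p < s \<and> s < ?n \<and> ?i < w ! s} = {p<..<?n}" using gt by auto
  ultimately show False using gp(2) run(4) zeros[OF \<open>?i \<in> set w\<close>] by simp
qed

end

section \<open>The characterization\<close>

lemma BigRep_le_TotalRep: "i > 0 \<Longrightarrow> BigRep n w i \<le> TotalRep n w i"
  unfolding BigRep_def TotalRep_def by (intro sum_mono2) auto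

lemma slides_False_iff:
  assumes "w \<noteq> []" "set w \<subseteq> {1..length w}"
  shows "bij_betw (outer_label w) {0..length w} {0..length w} \<and> (\<forall>p<length w. slides False w p)
    \<longleftrightarrow> avoids_2_1_2 w \<and> avoids_23_bar2_1 w \<and>
      (\<forall>i\<in>set w. card (zero_labels w i) \<le> TotalRep (length w) w i + last_group w i)"
    (is "?L \<longleftrightarrow> ?R")
proof
  assume ?L
  then interpret psi_word w
    using assms by unfold_locales (auto simp: slides_def)
  show ?R using avoids_212 avoids_23_bar_2_1 zeros_le_TotalRep by blast
next
  assume ?R
  then interpret avoiding_word w
    using assms by unfold_locales auto
  show ?L unfolding slides_def using bij leaf_between min_on_left by blast
qed

lemma slides_True_iff:
  assumes "w \<noteq> []" "set w \<subseteq> {1..length w}"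
  shows "bij_betw (outer_label w) {0..length w} {0..length w} \<and> (\<forall>p<length w. slides True w p)
    \<longleftrightarrow> avoids_2_1_2 w \<and> avoids_23_bar2_1 w \<and>
      (\<forall>i\<in>set w. card (zero_labels w i) \<le> BigRep (length w) w i)"
    (is "?L \<longleftrightarrow> ?R")
proof
  assume ?L
  then interpret omega_word w
    using assms by unfold_locales (auto simp: slides_def)
  show ?R using avoids_212 avoids_23_bar_2_1 zeros_le_BigRep by blast
next
  assume R: ?R
  have "card (zero_labels w i) \<le> TotalRep (length w) w i + last_group w i" if "i \<in> set w" for i
    using R that BigRep_le_TotalRep[of i "length w" w] assms(2) by fastforce
  then interpret avoiding_word w
    using R assms by unfold_locales auto
  show ?L unfolding slides_def using bij leaf_between min_on_left smaller_on_right R by blast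
qed

theorem theorem1p4:
  fixes n :: nat and k :: "nat \<Rightarrow> nat" and w :: "nat list"
  assumes "n \<ge> 1"
    and "composition n k"
    and "reverse_Catalan n k"
    and "has_content n k w"
  shows "(tree w \<in> Slide_psi n k \<and> reads (the (psi_labeling n k (tree w))) w \<longleftrightarrow>
            avoids_2_1_2 w \<and> avoids_23_bar2_1 w \<and>
            (\<forall>i\<in>{1..n}. k i > 0 \<longrightarrow> TotalRep n w i + last_group w i \<ge> zeros_after n k i)) \<and>
         (tree w \<in> Slide_omega n k \<and> reads (the (omega_labeling n k (tree w))) w \<longleftrightarrow>
            avoids_2_1_2 w \<and> avoids_23_bar2_1 w \<and>
            (\<forall>i\<in>{1..n}. k i > 0 \<longrightarrow> BigRep n w i \<ge> zeros_after n k i))"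
proof -
  have set_w: "set w \<subseteq> {1..n}" and count: "\<And>i. i \<in> {1..n} \<Longrightarrow> count_list w i = k i"
    using assms(4) by (auto simp: has_content_def)
  have "length w = (\<Sum>i\<in>{1..n}. count_list w i)" using sum_count_set[OF set_w] by simp
  also have "\<dots> = (\<Sum>i=1..n. k i)" using count by (intro sum.cong) auto
  also have "\<dots> = n" using assms(2) by (simp add: composition_def)
  finally have n: "length w = n" .
  then have w: "w \<noteq> []" "set w \<subseteq> {1..length w}" using assms(1) set_w by auto
  have letter: "(i \<in> {1..n} \<and> k i > 0) \<longleftrightarrow> i \<in> set w" for i
  proof (cases "i \<in> {1..n}")
    case True
    then show ?thesis using count[OF True] count_list_0_iff[of w i] by (metis neq0_conv)
  next
    case False
    then show ?thesis using set_w by blast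
  qed
  have zeros: "zeros_after n k i = card (zero_labels w i)" for i
    using zeros_after_eq[of w k i] assms(4) n by simp
  have psi: "psi_labeling = slide_labeling (slide_cond False)"
    unfolding psi_labeling_def slide_cond_def by simp
  have omega: "omega_labeling = slide_labeling (slide_cond True)"
    unfolding omega_labeling_def slide_cond_def by simp
  have "(tree w \<in> Slide_psi n k \<and> reads (the (psi_labeling n k (tree w))) w) \<longleftrightarrow>
     avoids_2_1_2 w \<and> avoids_23_bar2_1 w \<and>
      (\<forall>i\<in>set w. zeros_after n k i \<le> TotalRep n w i + last_group w i)"
    using slide_labeling_reads_iff[OF assms(1,4) n, of False] slides_False_iff[OF w]
    unfolding Slide_psi_def psi zeros n by simp
  moreover have "(tree w \<in> Slide_omega n k \<and> reads (the (omega_labeling n k (tree w))) w) \<longleftrightarrow>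
     avoids_2_1_2 w \<and> avoids_23_bar2_1 w \<and> (\<forall>i\<in>set w. zeros_after n k i \<le> BigRep n w i)"
    using slide_labeling_reads_iff[OF assms(1,4) n, of True] slides_True_iff[OF w]
    unfolding Slide_omega_def omega zeros n by simp
  moreover have "(\<forall>i\<in>{1..n}. k i > 0 \<longrightarrow> P i) \<longleftrightarrow> (\<forall>i\<in>set w. P i)" for P
    using letter by blast
  ultimately show ?thesis by simp
qed

end
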